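(* Let $W$ be a simple finite-dimensional $U_q(\widehat{\mathfrak g'})$-module with $\sigma$-invariant highest monomial, let $u\in H=(H')^\sigma$, and let $W(u)\subset W$ be the invariant subspace. Suppose that the Baxter polynomials encoding the joint eigenvalues of $Q_j^{+,\mathrm{ss}}(z,u)$, $j\in I'$, on a joint eigenvector in $W(u)$ are generic, so that their roots $w^{(j)}_r$ ($j\in I'$, $1\le r\le m_j$) satisfy the Bethe Ansatz equations of $\mathfrak g'$: $$\kappa_i(u)\,q^{\deg P_{i}}\frac{P_{i}(q^{-1}/w_r^{(i)})}{P_{i}(q/w_r^{(i)})}=-\prod_{s\ne r}\frac{w_r^{(i)}-w_s^{(i)}q^{-2}}{w_r^{(i)}-w_s^{(i)}q^{2}}\prod_{j\neq i}\prod_{s=1}^{m_j}\frac{w_r^{(i)}-w_s^{(j)}q^{-C'_{ij}}}{w_r^{(i)}-w_s^{(j)}q^{C'_{ij}}},\quad i\in I'.$$ Then, after identifying the roots of the polynomials corresponding to $Q_j^{+,\mathrm{ss}}(z,u)$ and $Q_{\sigma(j)}^{+,\mathrm{ss}}(z,u)$, one obtains a solution $w^{(i)}_r$ ($i\in I=I'/\langle\sigma\rangle$, $1\le r\le m_i$) of the folded Bethe Ansatz equations of $\mathfrak g$: $$\kappa_i(u)\,q^{\deg P_{i}}\frac{P_{i}(q^{-1}/w_r^{(i)})}{P_{i}(q/w_r^{(i)})}=-\prod_{s\ne r}\frac{w_r^{(i)}-w_s^{(i)}q^{-2}}{w_r^{(i)}-w_s^{(i)}q^{2}}\prod_{j\neq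 i}\prod_{s=1}^{m_j}\frac{(w_r^{(i)}-w_s^{(j)}q)^{-C_{ji}}}{(w_r^{(i)}-w_s^{(j)}q^{-1})^{-C_{ji}}},\quad i\in I.$$
   Context: $\mathfrak g'$ is a simply-laced simple Lie algebra with diagram automorphism $\sigma$ and $\mathfrak g=(\mathfrak g')^\sigma$: $(\mathfrak g',\mathfrak g)=(A_{2\ell-1},C_\ell)$, $(D_{\ell+1},B_\ell)$, $(E_6,F_4)$ (order 2), $(D_4,G_2)$ (order 3). $I'$, $I=I'/\langle\sigma\rangle$ are the vertex sets, $C'$, $C$ the Cartan matrices, $C_{ij}=2(\alpha_i,\alpha_j)/(\alpha_i,\alpha_i)$. $H'$ is the Cartan subgroup of the simply-connected group of $\mathfrak g'$, $P$ the weight lattice of $\mathfrak g'$, $P^\sigma$ its $\sigma$-invariant part. $q\in\mathbb C^\times$ is not a root of unity. $W$ has Drinfeld polynomials $P_i$, $i\in I'$ (constant term $1$); $\sigma$-invariance of the highest monomial means $P_i=P_{\sigma(i)}$. $\kappa_i(u)$ is a twist constant equal to $\alpha_i(u)$ for all $i$ or to $\alpha_i(u)^{-1}$ for all $i$ depending on conventions; since $u$ is $\sigma$-invariant, $\kappa_i(u)=\kappa_{\sigma(i)}(u)$. Transfer-matrices. Let $U_q(\widehat{\mathfrak b}')\subset U_q(\widehat{\mathfrak g'})$ be the Borel subalgebra generated by the Drinfeld–Jimbo generators $e_i,k_i^{\pm1}$, $0\le i\le |I'|$. The category $\mathcal O^*$ consists of the Cartan-diagonalizable $U_q(\widehat{\mathfrak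 b}')$-modules whose graded dual lies in the category $\mathcal O$ of Hernandez–Jimbo; its simple objects are determined by lowest $\ell$-weights. The prefundamental representation $R_j^{\pm}(a)$ is the simple object whose lowest $\ell$-weight is $(1-za)^{\pm1}$ in the $j$th component and $1$ in the other components. For $V\in\mathcal O^*$ and $u\in H'$, $t_V(z,u)$ is the formal power series in $z$ of operators on $W$ obtained as the trace over $V$ (with spectral parameter shifted by $z$ and with $u$ inserted, acting on a weight-$\omega$ vector by $\omega(u)$) of the universal $R$-matrix of $U_q(\widehat{\mathfrak g'})$, with the second factor acting on $W$. All $t_V(z,u)$ with fixed $u$ commute. $Q_j^{\pm}(z,u)=t_{R_j^\pm}(z,u)$, and the superscript $\mathrm{ss}$ denotes semi-simplification (the diagonalizable operator with the same generalized eigenspaces and eigenvalues). By Frenkel–Hernandez, every eigenvalue of $Q_j^{+,\mathrm{ss}}(z,u)$ on $W$ is a polynomial in $z$ (the Baxter polynomial) times a function of $z$ depending only on $W$; joint eigenspaces lie in $\mathfrak g'$-weight subspaces. Invariant subspace: $W(u)=\bigoplus_{\gamma\in P^\sigma}W_\gamma(u)$ with $W_\gamma(u)=\{w\in W_\gamma\mid Q_j^{\pm,\mathrm{ss}}(z,u)w=Q_{\sigma(j)}^{\pm,\mathrm{ss}}(z,u)w\ \ \forall j\in I'\}$. *)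

theory Defs
  imports
    "HOL-Analysis.Infinite_Sum"
    "HOL-Computational_Algebra.Computational_Algebra"
begin

section \<open>Simply-laced diagrams, their automorphisms, and folding\<close>

text \<open>
  The pairs \<open>(\<gg>', \<gg>)\<close>: \<open>A_C l\<close> is \<open>(A_{2l-1}, C_l)\<close>, \<open>D_B l\<close> is \<open>(D_{l+1}, B_l)\<close>.
  The vertices of the Dynkin diagram of \<open>\<gg>'\<close> are \<open>1, ..., rk\<close> in Bourbaki's labelling, and \<open>0\<close>
  is the additional vertex of the untwisted affine diagram.
\<close>

datatype folding = A_C nat | D_B nat | E6_F4 | D4_G2

fun valid_folding :: "folding \<Rightarrow> bool" where
  "valid_folding (A_C l) = (l \<ge> 2)"
| "valid_folding (D_B l) = (l \<ge> 3)"
| "valid_folding E6_F4 = True"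
| "valid_folding D4_G2 = True"

fun rk :: "folding \<Rightarrow> nat" where
  "rk (A_C l) = 2 * l - 1"
| "rk (D_B l) = l + 1"
| "rk E6_F4 = 6"
| "rk D4_G2 = 4"

definition verts :: "folding \<Rightarrow> nat set" where
  "verts X = {1..rk X}"

fun edges :: "folding \<Rightarrow> (nat \<times> nat) set" where
  "edges (A_C l) = {(i, Suc i) |i. 1 \<le> i \<and> i < 2 * l - 1}"
| "edges (D_B l) = {(i, Suc i) |i. 1 \<le> i \<and> i < l} \<union> {(l - 1, l + 1)}"
| "edges E6_F4 = {(1, 3), (3, 4), (4, 5), (5, 6), (2, 4)}"
| "edges D4_G2 = {(1, 2), (2, 3), (2, 4)}"

fun sigma :: "folding \<Rightarrow> nat \<Rightarrow> nat" where
  "sigma (A_C l) i = (if i \<in> {1..2 * l - 1} then 2 * l - i else i)"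
| "sigma (D_B l) i = (if i = l then l + 1 else if i = l + 1 then l else i)"
| "sigma E6_F4 i = (if i = 1 then 6 else if i = 6 then 1 else if i = 3 then 5 else if i = 5 then 3 else i)"
| "sigma D4_G2 i = (if i = 1 then 3 else if i = 3 then 4 else if i = 4 then 1 else i)"

definition cartan :: "folding \<Rightarrow> nat \<Rightarrow> nat \<Rightarrow> int" where
  "cartan X i j = (if i = j then 2 else if (i, j) \<in> edges X \<or> (j, i) \<in> edges X then -1 else 0)"

text \<open>Coefficients of the imaginary root \<open>\<delta> = \<alpha>_0 + \<theta>\<close>.\<close>

fun mark :: "folding \<Rightarrow> nat \<Rightarrow> nat" where
  "mark (A_C l) i = 1"
| "mark (D_B l) i = (if 2 \<le> i \<and> i \<le> l - 1 then 2 else 1)"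
| "mark E6_F4 i = (if i = 4 then 3 else if i \<in> {2, 3, 5} then 2 else 1)"
| "mark D4_G2 i = (if i = 2 then 2 else 1)"

text \<open>The affine Cartan matrix, from \<open>\<alpha>_0 = -\<theta>\<close> modulo \<open>\<delta>\<close>.\<close>

definition acartan :: "folding \<Rightarrow> nat \<Rightarrow> nat \<Rightarrow> int" where
  "acartan X i j =
    (if i = 0 \<and> j = 0 then 2
     else if i = 0 then - (\<Sum>l\<in>verts X. int (mark X l) * cartan X l j)
     else if j = 0 then - (\<Sum>l\<in>verts X. int (mark X l) * cartan X i l)
     else cartan X i j)"

text \<open>
  The vertices of \<open>I = I'/\<langle>\<sigma>\<rangle>\<close> are orbits. The simple root of \<open>\<gg> = (\<gg>')^\<sigma>\<close> attached to an orbit is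
  the common restriction of the \<open>\<alpha>_i\<close> to the \<open>\<sigma>\<close>-fixed Cartan subalgebra, i.e.\ their average over
  the orbit; this gives the form, and hence the Cartan matrix, of \<open>\<gg>\<close>.
\<close>

definition orbit :: "folding \<Rightarrow> nat \<Rightarrow> nat set" where
  "orbit X i = {(sigma X ^^ k) i |k. True}"

definition folded_verts :: "folding \<Rightarrow> nat set set" where
  "folded_verts X = orbit X ` verts X"

definition folded_form :: "folding \<Rightarrow> nat set \<Rightarrow> nat set \<Rightarrow> rat" where
  "folded_form X a b =
    (\<Sum>i\<in>a. \<Sum>j\<in>b. of_int (cartan X i j)) / (of_nat (card a) * of_nat (card b))"

text \<open>The quotient below is an integer; the floor only converts its type.\<close>

definition folded_cartan :: "folding \<Rightarrow> nat set \<Rightarrow> nat set \<Rightarrow> int" where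
  "folded_cartan X a b = \<lfloor>2 * folded_form X a b / folded_form X a a\<rfloor>"


section \<open>Modules over the quantum affine algebra and its Borel subalgebra\<close>

record 'v borel_module =
  scl :: "complex \<Rightarrow> 'v \<Rightarrow> 'v"
  eop :: "nat \<Rightarrow> 'v \<Rightarrow> 'v"
  kop :: "nat \<Rightarrow> 'v \<Rightarrow> 'v"

record 'v affine_module = "'v borel_module" +
  fop :: "nat \<Rightarrow> 'v \<Rightarrow> 'v"

definition qint :: "complex \<Rightarrow> nat \<Rightarrow> complex" where
  "qint q n = (q ^ n - (1 / q) ^ n) / (q - 1 / q)"

definition qbinom :: "complex \<Rightarrow> nat \<Rightarrow> nat \<Rightarrow> complex" where
  "qbinom q n r = (\<Prod>k=1..n. qint q k) / ((\<Prod>k=1..r. qint q k) * (\<Prod>k=1..n - r. qint q k))"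

definition quantum_serre ::
  "folding \<Rightarrow> complex \<Rightarrow> (complex \<Rightarrow> 'v \<Rightarrow> 'v) \<Rightarrow> (nat \<Rightarrow> 'v \<Rightarrow> 'v::ab_group_add) \<Rightarrow> bool" where
  "quantum_serre X q s x \<longleftrightarrow>
    (\<forall>i\<le>rk X. \<forall>j\<le>rk X. i \<noteq> j \<longrightarrow>
      (let N = nat (1 - acartan X i j) in
       \<forall>v. (\<Sum>r\<le>N. s ((-1) ^ r * qbinom q N r) ((x i ^^ (N - r)) (x j ((x i ^^ r) v)))) = 0))"

text \<open>
  Level zero: the central element \<open>\<Prod>\<^sub>i k_i^{a_i}\<close> acts by \<open>1\<close>. Both algebras are given by their
  Drinfeld-Jimbo presentations.
\<close>

definition is_borel_module ::
  "folding \<Rightarrow> complex \<Rightarrow> ('v::ab_group_add, 'x) borel_module_scheme \<Rightarrow> bool" where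
  "is_borel_module X q V \<longleftrightarrow>
    vector_space (scl V) \<and>
    (\<forall>i\<le>rk X. Vector_Spaces.linear (scl V) (scl V) (eop V i) \<and>
       Vector_Spaces.linear (scl V) (scl V) (kop V i) \<and> bij (kop V i)) \<and>
    (\<forall>i\<le>rk X. \<forall>j\<le>rk X. \<forall>v.
       kop V i (kop V j v) = kop V j (kop V i v) \<and>
       kop V i (eop V j v) = scl V (q powi acartan X i j) (eop V j (kop V i v))) \<and>
    (\<forall>v. fold (\<lambda>i. kop V i ^^ mark X i) [1..<Suc (rk X)] (kop V 0 v) = v) \<and>
    quantum_serre X q (scl V) (eop V)"

definition is_affine_module ::
  "folding \<Rightarrow> complex \<Rightarrow> ('v::ab_group_add, 'x) affine_module_scheme \<Rightarrow> bool" where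
  "is_affine_module X q V \<longleftrightarrow>
    is_borel_module X q V \<and>
    (\<forall>i\<le>rk X. Vector_Spaces.linear (scl V) (scl V) (fop V i)) \<and>
    (\<forall>i\<le>rk X. \<forall>j\<le>rk X. \<forall>v.
       kop V i (fop V j v) = scl V (q powi (- acartan X i j)) (fop V j (kop V i v)) \<and>
       eop V i (fop V j v) - fop V j (eop V i v) =
         (if i = j then scl V (1 / (q - 1 / q)) (kop V i v - inv (kop V i) v) else 0)) \<and>
    quantum_serre X q (scl V) (fop V)"

definition borel_invariant ::
  "folding \<Rightarrow> ('v::ab_group_add, 'x) borel_module_scheme \<Rightarrow> 'v set \<Rightarrow> bool" where
  "borel_invariant X V S \<longleftrightarrow>
    module.subspace (scl V) S \<and>
    (\<forall>i\<le>rk X. eop V i ` S \<subseteq> S \<and> kop V i ` S \<subseteq> S \<and> inv (kop V i) ` S \<subseteq> S)"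

definition simple_borel_module ::
  "folding \<Rightarrow> complex \<Rightarrow> ('v::ab_group_add, 'x) borel_module_scheme \<Rightarrow> bool" where
  "simple_borel_module X q V \<longleftrightarrow>
    is_borel_module X q V \<and> (UNIV :: 'v set) \<noteq> {0} \<and>
    (\<forall>S. borel_invariant X V S \<longrightarrow> S = {0} \<or> S = UNIV)"

definition simple_affine_module ::
  "folding \<Rightarrow> complex \<Rightarrow> ('v::ab_group_add, 'x) affine_module_scheme \<Rightarrow> bool" where
  "simple_affine_module X q V \<longleftrightarrow>
    is_affine_module X q V \<and> (UNIV :: 'v set) \<noteq> {0} \<and>
    (\<forall>S. borel_invariant X V S \<and> (\<forall>i\<le>rk X. fop V i ` S \<subseteq> S) \<longrightarrow> S = {0} \<or> S = UNIV)"

definition finite_dim :: "(complex \<Rightarrow> 'v::ab_group_add \<Rightarrow> 'v) \<Rightarrow> 'v set \<Rightarrow> bool" where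
  "finite_dim s S \<longleftrightarrow> (\<exists>B. finite B \<and> S \<subseteq> module.span s B)"

text \<open>Weights are families of eigenvalues of \<open>k_i\<close>, \<open>i \<in> I'\<close>.\<close>

definition weight_space ::
  "folding \<Rightarrow> ('v::ab_group_add, 'x) borel_module_scheme \<Rightarrow> (nat \<Rightarrow> complex) \<Rightarrow> 'v set" where
  "weight_space X V \<omega> = {v. \<forall>i\<in>verts X. kop V i v = scl V (\<omega> i) v}"

text \<open>The weight \<open>\<Sum>\<^sub>j \<gamma>_j \<alpha>_j\<close> of the root lattice.\<close>

definition root_weight :: "folding \<Rightarrow> complex \<Rightarrow> (nat \<Rightarrow> nat) \<Rightarrow> nat \<Rightarrow> complex" where
  "root_weight X q \<gamma> i = q powi (\<Sum>j\<in>verts X. cartan X i j * int (\<gamma> j))"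

text \<open>Elements of the weight lattice \<open>P\<close> are given by their values \<open>\<mu>_i\<close> on the simple coroots.\<close>

definition P_weight :: "complex \<Rightarrow> (nat \<Rightarrow> int) \<Rightarrow> nat \<Rightarrow> complex" where
  "P_weight q \<mu> i = q powi \<mu> i"


section \<open>Drinfeld currents\<close>

definition qcomm ::
  "('v::ab_group_add, 'x) borel_module_scheme \<Rightarrow> complex \<Rightarrow> ('v \<Rightarrow> 'v) \<Rightarrow> ('v \<Rightarrow> 'v) \<Rightarrow> 'v \<Rightarrow> 'v" where
  "qcomm V c A B v = A (B v) - scl V c (B (A v))"

text \<open>
  A sequence \<open>p\<close> of vertices of \<open>I'\<close> along which one passes from \<open>\<alpha>_0\<close> to \<open>\<delta> - \<alpha>_i\<close> through real
  roots, adding one simple root at each step. The iterated \<open>q\<close>-commutator of the \<open>e_j\<close> along \<open>p\<close> is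
  the root vector of \<open>\<delta> - \<alpha>_i\<close>; it does not depend on \<open>p\<close>.
\<close>

definition delta_path :: "folding \<Rightarrow> nat \<Rightarrow> nat list \<Rightarrow> bool" where
  "delta_path X i p \<longleftrightarrow>
    set p \<subseteq> verts X \<and>
    (\<forall>l\<in>verts X. count_list p l = mark X l - (if l = i then 1 else 0)) \<and>
    (\<forall>k<length p. acartan X (p ! k) 0 + (\<Sum>t<k. acartan X (p ! k) (p ! t)) = -1)"

text \<open>The sign function \<open>o\<close> with \<open>o(i) o(j) = -1\<close> on adjacent vertices.\<close>

definition osign :: "folding \<Rightarrow> nat \<Rightarrow> complex" where
  "osign X = (SOME s. s 1 = 1 \<and> (\<forall>i\<in>verts X. s i \<in> {1, -1}) \<and>
    (\<forall>(i, j)\<in>edges X. s j = - s i))"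

definition delta_root_vector ::
  "folding \<Rightarrow> complex \<Rightarrow> ('v::ab_group_add, 'x) borel_module_scheme \<Rightarrow> nat \<Rightarrow> 'v \<Rightarrow> 'v" where
  "delta_root_vector X q V i =
    foldl (\<lambda>E j. qcomm V q (eop V j) E) (eop V 0) (SOME p. delta_path X i p)"

text \<open>
  The part of the Drinfeld generators lying in the Borel subalgebra:
  \<open>x\<^sup>-_{i,m}\<close> (\<open>m \<ge> 1\<close>), \<open>h_{i,1}\<close>, \<open>x\<^sup>+_{i,m}\<close> and \<open>\<phi>\<^sup>+_{i,m}\<close> (\<open>m \<ge> 0\<close>). They are determined by
  \<open>x\<^sup>-_{i,1} = o(i) E_{\<delta>-\<alpha>_i} k_i\<close>, \<open>h_{i,1} = k_i\<inverse> [e_i, x\<^sup>-_{i,1}]\<close>,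
  \<open>[h_{i,1}, x\<^sup>\<plusminus>_{i,m}] = \<plusminus> [2]_q x\<^sup>\<plusminus>_{i,m+1}\<close> and
  \<open>[e_i, x\<^sup>-_{i,m}] = \<phi>\<^sup>+_{i,m} / (q - q\<inverse>)\<close> for \<open>m \<ge> 1\<close>.
  A common rescaling of all \<open>x\<^sup>-_{i,1}\<close> would only rescale all spectral parameters simultaneously.
\<close>

definition xminus1 ::
  "folding \<Rightarrow> complex \<Rightarrow> ('v::ab_group_add, 'x) borel_module_scheme \<Rightarrow> nat \<Rightarrow> 'v \<Rightarrow> 'v" where
  "xminus1 X q V i v = scl V (osign X i) (delta_root_vector X q V i (kop V i v))"

definition h1 ::
  "folding \<Rightarrow> complex \<Rightarrow> ('v::ab_group_add, 'x) borel_module_scheme \<Rightarrow> nat \<Rightarrow> 'v \<Rightarrow> 'v" where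
  "h1 X q V i v = inv (kop V i) (qcomm V 1 (eop V i) (xminus1 X q V i) v)"

text \<open>\<open>xminus_Suc X q V i m\<close> is \<open>x\<^sup>-_{i,m+1}\<close>.\<close>

primrec xminus_Suc ::
  "folding \<Rightarrow> complex \<Rightarrow> ('v::ab_group_add, 'x) borel_module_scheme \<Rightarrow> nat \<Rightarrow> nat \<Rightarrow> 'v \<Rightarrow> 'v" where
  "xminus_Suc X q V i 0 = xminus1 X q V i"
| "xminus_Suc X q V i (Suc m) =
    (\<lambda>v. scl V (- 1 / qint q 2) (qcomm V 1 (h1 X q V i) (xminus_Suc X q V i m) v))"

primrec xplus ::
  "folding \<Rightarrow> complex \<Rightarrow> ('v::ab_group_add, 'x) borel_module_scheme \<Rightarrow> nat \<Rightarrow> nat \<Rightarrow> 'v \<Rightarrow> 'v" where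
  "xplus X q V i 0 = eop V i"
| "xplus X q V i (Suc m) =
    (\<lambda>v. scl V (1 / qint q 2) (qcomm V 1 (h1 X q V i) (xplus X q V i m) v))"

primrec phi ::
  "folding \<Rightarrow> complex \<Rightarrow> ('v::ab_group_add, 'x) borel_module_scheme \<Rightarrow> nat \<Rightarrow> nat \<Rightarrow> 'v \<Rightarrow> 'v" where
  "phi X q V i 0 = kop V i"
| "phi X q V i (Suc m) =
    (\<lambda>v. scl V (q - 1 / q) (qcomm V 1 (eop V i) (xminus_Suc X q V i m) v))"

text \<open>\<open>v\<close> is a joint eigenvector of the \<open>\<phi>\<^sup>+_i(z)\<close>, with eigenvalues \<open>\<Psi>_i(z)\<close>.\<close>

definition has_l_weight ::
  "folding \<Rightarrow> complex \<Rightarrow> ('v::ab_group_add, 'x) borel_module_scheme \<Rightarrow> (nat \<Rightarrow> complex fps) \<Rightarrow> 'v \<Rightarrow> bool" where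
  "has_l_weight X q V \<Psi> v \<longleftrightarrow>
    v \<noteq> 0 \<and> (\<forall>i\<in>verts X. \<forall>m. phi X q V i m v = scl V (fps_nth (\<Psi> i) m) v)"

text \<open>
  Drinfeld polynomials: the highest \<open>\<ell>\<close>-weight of \<open>W\<close> is \<open>q^{deg P_i} P_i(z q\<inverse>) / P_i(z q)\<close>.
\<close>

definition drinfeld_l_weight :: "complex \<Rightarrow> (nat \<Rightarrow> complex poly) \<Rightarrow> nat \<Rightarrow> complex fps" where
  "drinfeld_l_weight q P i =
    fps_const (q ^ degree (P i)) * fps_of_poly (pcompose (P i) [:0, 1 / q:]) *
    inverse (fps_of_poly (pcompose (P i) [:0, q:]))"

definition has_drinfeld_polynomials ::
  "folding \<Rightarrow> complex \<Rightarrow> ('v::ab_group_add, 'x) affine_module_scheme \<Rightarrow> (nat \<Rightarrow> complex poly) \<Rightarrow> bool" where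
  "has_drinfeld_polynomials X q W P \<longleftrightarrow>
    (\<forall>i\<in>verts X. coeff (P i) 0 = 1) \<and>
    (\<exists>v. has_l_weight X q W (drinfeld_l_weight q P) v \<and>
         (\<forall>i\<in>verts X. \<forall>m. xplus X q W i m v = 0))"


section \<open>Category \<open>\<O>\<^sup>*\<close> and prefundamental representations\<close>

definition in_O_star ::
  "folding \<Rightarrow> complex \<Rightarrow> ('v::ab_group_add, 'x) borel_module_scheme \<Rightarrow> bool" where
  "in_O_star X q V \<longleftrightarrow>
    is_borel_module X q V \<and>
    module.span (scl V) (\<Union>\<omega>. weight_space X V \<omega>) = UNIV \<and>
    (\<forall>\<omega>. finite_dim (scl V) (weight_space X V \<omega>)) \<and>
    (\<exists>D. finite D \<and> (\<forall>\<omega>. weight_space X V \<omega> \<noteq> {0} \<longrightarrow>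
       (\<exists>\<tau>\<in>D. \<exists>\<gamma>. \<forall>i\<in>verts X. \<omega> i = \<tau> i * root_weight X q \<gamma> i)))"

text \<open>
  A lowest \<open>\<ell>\<close>-weight vector: besides being an \<open>\<ell>\<close>-weight vector, its weight is minimal, every
  weight of \<open>V\<close> being obtained from it by adding an element of the positive root cone.
\<close>

definition has_lowest_l_weight ::
  "folding \<Rightarrow> complex \<Rightarrow> ('v::ab_group_add, 'x) borel_module_scheme \<Rightarrow> (nat \<Rightarrow> complex fps) \<Rightarrow> bool" where
  "has_lowest_l_weight X q V \<Psi> \<longleftrightarrow>
    (\<exists>v. has_l_weight X q V \<Psi> v) \<and>
    (\<forall>\<omega>. weight_space X V \<omega> \<noteq> {0} \<longrightarrow>
       (\<exists>\<gamma>. \<forall>i\<in>verts X. \<omega> i = fps_nth (\<Psi> i) 0 * root_weight X q \<gamma> i))"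

definition is_prefundamental_plus ::
  "folding \<Rightarrow> complex \<Rightarrow> nat \<Rightarrow> complex \<Rightarrow> ('v::ab_group_add, 'x) borel_module_scheme \<Rightarrow> bool" where
  "is_prefundamental_plus X q j a V \<longleftrightarrow>
    simple_borel_module X q V \<and> in_O_star X q V \<and>
    has_lowest_l_weight X q V (\<lambda>i. if i = j then 1 - fps_const a * fps_X else 1)"

definition is_prefundamental_minus ::
  "folding \<Rightarrow> complex \<Rightarrow> nat \<Rightarrow> complex \<Rightarrow> ('v::ab_group_add, 'x) borel_module_scheme \<Rightarrow> bool" where
  "is_prefundamental_minus X q j a V \<longleftrightarrow>
    simple_borel_module X q V \<and> in_O_star X q V \<and>
    has_lowest_l_weight X q V (\<lambda>i. if i = j then inverse (1 - fps_const a * fps_X) else 1)"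


section \<open>The universal R-matrix\<close>

text \<open>
  A word \<open>[i_1, ..., i_n]\<close> stands for \<open>e_{i_1} \<cdots> e_{i_n}\<close> or \<open>f_{i_1} \<cdots> f_{i_n}\<close>. The pairing of the
  positive and negative parts is determined by \<open>\<langle>e_i x, y\<rangle> = (q\<inverse> - q)\<inverse> \<langle>x, \<partial>_i y\<rangle>\<close>, where
  \<open>\<partial>_i\<close> is the skew derivation removing a letter \<open>f_i\<close>, weighted by moving it to the left.
\<close>

primrec pairing :: "folding \<Rightarrow> complex \<Rightarrow> nat list \<Rightarrow> nat list \<Rightarrow> complex" where
  "pairing X q [] = (\<lambda>y. if y = [] then 1 else 0)"
| "pairing X q (i # x) = (\<lambda>y.
    (\<Sum>s\<in>{s. s < length y \<and> y ! s = i}.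
       q powi (\<Sum>t<s. acartan X i (y ! t)) * pairing X q x (take s y @ drop (Suc s) y)) / (1 / q - q))"

definition delta_words :: "folding \<Rightarrow> nat \<Rightarrow> nat list set" where
  "delta_words X n =
    {w. set w \<subseteq> {0..rk X} \<and> count_list w 0 = n \<and> (\<forall>i\<in>verts X. count_list w i = n * mark X i)}"

text \<open>
  With respect to the coproduct \<open>\<Delta>(e_i) = e_i \<otimes> 1 + k_i \<otimes> e_i\<close>,
  \<open>\<Delta>(f_i) = f_i \<otimes> k_i\<inverse> + 1 \<otimes> f_i\<close>, the universal R-matrix is \<open>(\<Sum>\<^sub>\<beta> \<Theta>_\<beta>) q^{-t}\<close>, where
  \<open>\<Theta>_\<beta> = \<Sum> c(b,b') e_b \<otimes> f_{b'}\<close> is the canonical element of the pairing in weight \<open>\<beta>\<close> and \<open>q^{-t}\<close>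
  acts by \<open>q^{-(\<omega>,\<mu>)}\<close> on vectors of weights \<open>\<omega>\<close>, \<open>\<mu>\<close>. Words are a spanning set rather than a basis,
  so \<open>c\<close> is a generalized inverse of the Gram matrix; two choices differ by the radical of the
  pairing, and give the same \<open>\<Theta>_\<beta>\<close>. Only \<open>\<beta> = n \<delta>\<close> is needed: the other \<open>\<Theta>_\<beta>\<close> change
  the weight of the first factor and do not contribute to a trace over it.
\<close>

definition theta_coeff :: "folding \<Rightarrow> complex \<Rightarrow> nat \<Rightarrow> nat list \<Rightarrow> nat list \<Rightarrow> complex" where
  "theta_coeff X q n = (SOME c. \<forall>x\<in>delta_words X n. \<forall>y\<in>delta_words X n.
    (\<Sum>b\<in>delta_words X n. \<Sum>b'\<in>delta_words X n.
       pairing X q x b' * c b b' * pairing X q b y) = pairing X q x y)"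

definition word_op :: "(nat \<Rightarrow> 'v \<Rightarrow> 'v) \<Rightarrow> nat list \<Rightarrow> 'v \<Rightarrow> 'v" where
  "word_op x w = foldr (\<lambda>i F. x i \<circ> F) w id"


section \<open>Transfer-matrices\<close>

definition trace_on :: "(complex \<Rightarrow> 'v::ab_group_add \<Rightarrow> 'v) \<Rightarrow> 'v set \<Rightarrow> ('v \<Rightarrow> 'v) \<Rightarrow> complex" where
  "trace_on s S A =
    (let B = (SOME B. B \<subseteq> S \<and> \<not> module.dependent s B \<and> S \<subseteq> module.span s B)
     in \<Sum>b\<in>B. module.representation s B (A b) b)"

text \<open>
  The torus of the simply-connected group is \<open>Hom(P, \<complex>\<^sup>\<times>)\<close>; its element \<open>u\<close> is given by the values
  \<open>u_i\<close> of the fundamental weights.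
\<close>

definition in_torus :: "folding \<Rightarrow> (nat \<Rightarrow> complex) \<Rightarrow> bool" where
  "in_torus X u \<longleftrightarrow> (\<forall>i\<in>verts X. u i \<noteq> 0)"

definition root_value :: "folding \<Rightarrow> (nat \<Rightarrow> complex) \<Rightarrow> nat \<Rightarrow> complex" where
  "root_value X u i = (\<Prod>j\<in>verts X. u j powi cartan X j i)"

definition root_cone :: "folding \<Rightarrow> (nat \<Rightarrow> nat) set" where
  "root_cone X = {\<gamma>. \<forall>i. i \<notin> verts X \<longrightarrow> \<gamma> i = 0}"

text \<open>
  The trace over an infinite-dimensional module is a sum over its weights. It is the value of the
  sum where this converges; elsewhere the trace is understood by continuation: the sum is a rational
  function of a parameter \<open>t\<close> counting heights of weights, which is evaluated at \<open>t = 1\<close>.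
\<close>

definition cone_sum :: "folding \<Rightarrow> ((nat \<Rightarrow> nat) \<Rightarrow> complex) \<Rightarrow> complex" where
  "cone_sum X a =
    (if a summable_on root_cone X then infsum a (root_cone X)
     else (THE c. \<exists>p r. poly r 1 \<noteq> 0 \<and> c = poly p 1 / poly r 1 \<and>
       fps_of_poly r *
         Abs_fps (\<lambda>n. \<Sum>\<gamma>\<in>{\<gamma> \<in> root_cone X. (\<Sum>i\<in>verts X. \<gamma> i) = n}. a \<gamma>) = fps_of_poly p))"

text \<open>
  \<open>Tr_V(u q^{-(\<cdot>,\<mu>)} e_b)\<close> for modules whose weights lie in the positive root cone, such as the
  prefundamental representations.
\<close>

definition twisted_trace ::
  "folding \<Rightarrow> complex \<Rightarrow> ('v::ab_group_add, 'x) borel_module_scheme \<Rightarrow> (nat \<Rightarrow> complex) \<Rightarrow>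
    (nat \<Rightarrow> int) \<Rightarrow> nat list \<Rightarrow> complex" where
  "twisted_trace X q V u \<mu> b =
    cone_sum X (\<lambda>\<gamma>. (\<Prod>i\<in>verts X. root_value X u i ^ \<gamma> i) *
      q powi (- (\<Sum>i\<in>verts X. int (\<gamma> i) * \<mu> i)) *
      trace_on (scl V) (weight_space X V (root_weight X q \<gamma>)) (word_op (eop V) b))"

text \<open>
  The coefficient of \<open>z\<^sup>n\<close> of \<open>t_V(z,u)\<close> on \<open>W\<close>; the spectral parameter is introduced by
  \<open>e_0 \<mapsto> z e_0\<close>.
\<close>

definition transfer ::
  "folding \<Rightarrow> complex \<Rightarrow> ('v::ab_group_add, 'x) borel_module_scheme \<Rightarrow> (nat \<Rightarrow> complex) \<Rightarrow>
    ('w::ab_group_add, 'y) affine_module_scheme \<Rightarrow> nat \<Rightarrow> 'w \<Rightarrow> 'w" where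
  "transfer X q V u W n =
    (THE T. Vector_Spaces.linear (scl W) (scl W) T \<and>
      (\<forall>\<mu>. \<forall>w\<in>weight_space X W (P_weight q \<mu>).
         T w = (\<Sum>b\<in>delta_words X n. \<Sum>b'\<in>delta_words X n.
           scl W (theta_coeff X q n b b' * twisted_trace X q V u \<mu> b) (word_op (fop W) b' w))))"

text \<open>The semi-simplification acts by \<open>c\<close> on the generalized eigenspace of \<open>c\<close>.\<close>

definition semisimplification :: "(complex \<Rightarrow> 'w::ab_group_add \<Rightarrow> 'w) \<Rightarrow> ('w \<Rightarrow> 'w) \<Rightarrow> 'w \<Rightarrow> 'w" where
  "semisimplification s A =
    (THE S. Vector_Spaces.linear s s S \<and>
      (\<forall>c w. (\<exists>k. ((\<lambda>x. A x - s c x) ^^ k) w = 0) \<longrightarrow> S w = s c w))"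

text \<open>
  \<open>Q^{ss}\<close>, coefficientwise in \<open>z\<close>: the coefficients commute, so this is the semi-simplification
  with respect to their joint generalized eigenspaces.
\<close>

definition transfer_ss ::
  "folding \<Rightarrow> complex \<Rightarrow> ('v::ab_group_add, 'x) borel_module_scheme \<Rightarrow> (nat \<Rightarrow> complex) \<Rightarrow>
    ('w::ab_group_add, 'y) affine_module_scheme \<Rightarrow> nat \<Rightarrow> 'w \<Rightarrow> 'w" where
  "transfer_ss X q V u W n = semisimplification (scl W) (transfer X q V u W n)"

definition invariant_weight_part ::
  "folding \<Rightarrow> complex \<Rightarrow> (nat \<Rightarrow> ('v::ab_group_add, 'x) borel_module_scheme) \<Rightarrow>
    (nat \<Rightarrow> ('v, 'x) borel_module_scheme) \<Rightarrow> (nat \<Rightarrow> complex) \<Rightarrow>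
    ('w::ab_group_add, 'y) affine_module_scheme \<Rightarrow> (nat \<Rightarrow> int) \<Rightarrow> 'w set" where
  "invariant_weight_part X q Rp Rm u W \<gamma> =
    {w \<in> weight_space X W (P_weight q \<gamma>). \<forall>j\<in>verts X. \<forall>n.
       transfer_ss X q (Rp j) u W n w = transfer_ss X q (Rp (sigma X j)) u W n w \<and>
       transfer_ss X q (Rm j) u W n w = transfer_ss X q (Rm (sigma X j)) u W n w}"

definition invariant_subspace ::
  "folding \<Rightarrow> complex \<Rightarrow> (nat \<Rightarrow> ('v::ab_group_add, 'x) borel_module_scheme) \<Rightarrow>
    (nat \<Rightarrow> ('v, 'x) borel_module_scheme) \<Rightarrow> (nat \<Rightarrow> complex) \<Rightarrow>
    ('w::ab_group_add, 'y) affine_module_scheme \<Rightarrow> 'w set" where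
  "invariant_subspace X q Rp Rm u W =
    module.span (scl W)
      (\<Union>\<gamma>\<in>{\<gamma>. \<forall>i\<in>verts X. \<gamma> (sigma X i) = \<gamma> i}. invariant_weight_part X q Rp Rm u W \<gamma>)"


section \<open>Baxter polynomials\<close>

definition fps_dilate :: "complex \<Rightarrow> complex fps \<Rightarrow> complex fps" where
  "fps_dilate c f = Abs_fps (\<lambda>n. c ^ n * fps_nth f n)"

text \<open>
  The functions \<open>f_j(z)\<close>, depending only on \<open>W\<close>, by which the eigenvalues of \<open>Q_j\<^sup>+\<close> differ from the
  Baxter polynomials: up to a constant, \<open>f_j\<close> is the eigenvalue of \<open>Q_j\<^sup>+\<close> on the highest
  \<open>\<ell>\<close>-weight vector. If \<open>P_i(z) = \<Prod>\<^sub>k (1 - a_{i,k} z)\<close> and \<open>D(q)\<close> is the inverse of the quantum Cartan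
  matrix \<open>([C'_{ij}]_q)\<close>, then
  \<open>f_j(z) = exp (\<Sum>\<^sub>m \<Sum>\<^sub>i D_{ji}(q^m) (\<Sum>\<^sub>k a_{i,k}^{-m}) z^m / m)\<close>; equivalently, \<open>f_j(0) = 1\<close> and
  \<open>f_i(q z) f_i(q\<inverse> z) \<Prod>\<^sub>k (1 - z / a_{i,k}) = \<Prod> f_j(z)\<close>, the last product being over the
  neighbours \<open>j\<close> of \<open>i\<close>. The product over \<open>k\<close> is the normalized reversed polynomial of \<open>P_i\<close>.
\<close>

definition baxter_prefactors ::
  "folding \<Rightarrow> complex \<Rightarrow> (nat \<Rightarrow> complex poly) \<Rightarrow> (nat \<Rightarrow> complex fps) \<Rightarrow> bool" where
  "baxter_prefactors X q P f \<longleftrightarrow>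
    (\<forall>i\<in>verts X. fps_nth (f i) 0 = 1 \<and>
       fps_dilate q (f i) * fps_dilate (1 / q) (f i) *
         fps_of_poly (smult (1 / lead_coeff (P i)) (reflect_poly (P i))) =
       (\<Prod>j\<in>{j \<in> verts X. cartan X i j = -1}. f j))"

text \<open>\<open>w_1, ..., w_m\<close> are the roots of \<open>B\<close>, with multiplicities.\<close>

definition lists_roots :: "complex poly \<Rightarrow> nat \<Rightarrow> (nat \<Rightarrow> complex) \<Rightarrow> bool" where
  "lists_roots B m w \<longleftrightarrow> (\<exists>c. c \<noteq> 0 \<and> B = smult c (\<Prod>r=1..m. [:- w r, 1:]))"

text \<open>
  In the product over \<open>j \<noteq> i\<close>, the vertices with \<open>C'_{ij} = 0\<close> contribute the trivial factor \<open>1\<close> and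
  are omitted. (For \<open>j = \<sigma>(i)\<close> and equal roots the factor would formally read \<open>0 / 0\<close>.) Part of
  satisfying the equations is that all expressions are defined.
\<close>

definition bethe_equations ::
  "folding \<Rightarrow> complex \<Rightarrow> (nat \<Rightarrow> complex) \<Rightarrow> (nat \<Rightarrow> complex poly) \<Rightarrow>
    (nat \<Rightarrow> nat) \<Rightarrow> (nat \<Rightarrow> nat \<Rightarrow> complex) \<Rightarrow> bool" where
  "bethe_equations X q \<kappa> P m w \<longleftrightarrow>
    (\<forall>i\<in>verts X. \<forall>r\<in>{1..m i}.
       w i r \<noteq> 0 \<and> poly (P i) (q / w i r) \<noteq> 0 \<and>
       (\<forall>s\<in>{1..m i} - {r}. w i r - w i s * q\<^sup>2 \<noteq> 0) \<and>
       (\<forall>j\<in>verts X - {i}. cartan X i j \<noteq> 0 \<longrightarrow>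
          (\<forall>s\<in>{1..m j}. w i r - w j s * q powi cartan X i j \<noteq> 0)) \<and>
       \<kappa> i * q ^ degree (P i) * (poly (P i) (inverse q / w i r) / poly (P i) (q / w i r)) =
       - (\<Prod>s\<in>{1..m i} - {r}. (w i r - w i s * q powi (-2)) / (w i r - w i s * q\<^sup>2)) *
         (\<Prod>j\<in>{j \<in> verts X - {i}. cartan X i j \<noteq> 0}. \<Prod>s=1..m j.
            (w i r - w j s * q powi (- cartan X i j)) / (w i r - w j s * q powi cartan X i j)))"

text \<open>
  The unknowns are indexed by orbits. As \<open>\<kappa>\<close> and \<open>P\<close> are \<open>\<sigma>\<close>-invariant, the equation of an orbit
  may be written with any of its elements.
\<close>

definition folded_bethe_equations ::
  "folding \<Rightarrow> complex \<Rightarrow> (nat \<Rightarrow> complex) \<Rightarrow> (nat \<Rightarrow> complex poly) \<Rightarrow>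
    (nat set \<Rightarrow> nat) \<Rightarrow> (nat set \<Rightarrow> nat \<Rightarrow> complex) \<Rightarrow> bool" where
  "folded_bethe_equations X q \<kappa> P m w \<longleftrightarrow>
    (\<forall>a\<in>folded_verts X. \<forall>i\<in>a. \<forall>r\<in>{1..m a}.
       w a r \<noteq> 0 \<and> poly (P i) (q / w a r) \<noteq> 0 \<and>
       (\<forall>s\<in>{1..m a} - {r}. w a r - w a s * q\<^sup>2 \<noteq> 0) \<and>
       (\<forall>b\<in>folded_verts X - {a}. \<forall>s\<in>{1..m b}.
          (w a r - w b s * inverse q) powi (- folded_cartan X b a) \<noteq> 0) \<and>
       \<kappa> i * q ^ degree (P i) * (poly (P i) (inverse q / w a r) / poly (P i) (q / w a r)) =
       - (\<Prod>s\<in>{1..m a} - {r}. (w a r - w a s * q powi (-2)) / (w a r - w a s * q\<^sup>2)) *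
         (\<Prod>b\<in>folded_verts X - {a}. \<Prod>s=1..m b.
            (w a r - w b s * q) powi (- folded_cartan X b a) /
            (w a r - w b s * inverse q) powi (- folded_cartan X b a)))"

text \<open>
  The roots \<open>w^{(j)}\<close>, \<open>j \<in> I'\<close>, are identified along \<open>\<sigma>\<close>-orbits: up to reordering they
  depend only on the orbit of \<open>j\<close>.
\<close>

definition identified_roots ::
  "folding \<Rightarrow> (nat \<Rightarrow> nat) \<Rightarrow> (nat \<Rightarrow> nat \<Rightarrow> complex) \<Rightarrow>
    (nat set \<Rightarrow> nat) \<Rightarrow> (nat set \<Rightarrow> nat \<Rightarrow> complex) \<Rightarrow> bool" where
  "identified_roots X m w m' w' \<longleftrightarrow>
    (\<forall>j\<in>verts X. m' (orbit X j) = m j \<and>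
       (\<exists>\<pi>. bij_betw \<pi> {1..m j} {1..m j} \<and> (\<forall>r\<in>{1..m j}. w' (orbit X j) r = w j (\<pi> r))))"

end

theory Submission
  imports Defs "HOL-Combinatorics.Permutations"
begin

text \<open>
  The semi-simplified transfer-matrices are linear, so \<open>Q_j\<close> and \<open>Q_{\<sigma>(j)}\<close> agree on the span of the
  weight pieces defining \<open>W(u)\<close>, and their eigenvalues on \<open>v\<close> coincide. The prefactors \<open>f_j\<close> are
  \<open>\<sigma>\<close>-invariant because at the first order \<open>n\<close> where \<open>f\<close> and \<open>f \<circ> \<sigma>\<close> could differ, the difference of the
  coefficients lies in the kernel of the Cartan matrix deformed at \<open>q\<^sup>n\<close>, which is invertible as \<open>q\<close> is
  not a root of unity. Hence the Baxter polynomials of \<open>j\<close> and \<open>\<sigma>(j)\<close> are equal and have the same roots.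
  Distinct vertices of an orbit are never adjacent, and a vertex of an orbit \<open>a\<close> has exactly \<open>- C_{ba}\<close>
  neighbours in another orbit \<open>b\<close>; so, once the roots are identified, the factors of the neighbours in
  \<open>b\<close> combine into a power with exponent \<open>- C_{ba}\<close>.
\<close>

section \<open>Folding of the Bethe Ansatz equations\<close>

lemma sigma_order: "(\<forall>i. sigma X (sigma X i) = i) \<or> (\<forall>i. sigma X (sigma X (sigma X i)) = i)"
proof (cases X)
  case (A_C l)
  show ?thesis unfolding A_C by (rule disjI1) auto
next
  case (D_B l)
  show ?thesis unfolding D_B by (rule disjI1) simp
next
  case E6_F4
  show ?thesis unfolding E6_F4 by (rule disjI1) simp
next
  case D4_G2
  show ?thesis unfolding D4_G2 by (rule disjI2) simp
qed

text \<open>The exponent 6 is a common multiple of the orders 2 and 3, so injectivity and the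
  symmetry of orbits need no case distinction over the types.\<close>

lemma sigma_pow_6: "(sigma X ^^ 6) i = i"
  using sigma_order[of X]
proof
  assume *: "\<forall>i. sigma X (sigma X i) = i"
  show ?thesis by (simp add: numeral_eq_Suc *[rule_format])
next
  assume *: "\<forall>i. sigma X (sigma X (sigma X i)) = i"
  show ?thesis by (simp add: numeral_eq_Suc *[rule_format])
qed

lemma sigma_in_verts: "valid_folding X \<Longrightarrow> i \<in> verts X \<Longrightarrow> sigma X i \<in> verts X"
  by (cases X) (auto simp: verts_def)

lemma sigma_funpow_in_verts: "valid_folding X \<Longrightarrow> i \<in> verts X \<Longrightarrow> (sigma X ^^ k) i \<in> verts X"
  by (induction k) (auto intro: sigma_in_verts)

lemma inj_sigma: "inj (sigma X)"
proof (rule injI)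
  fix x y assume "sigma X x = sigma X y"
  hence "(sigma X ^^ 6) x = (sigma X ^^ 6) y"
    by (simp add: numeral_eq_Suc)
  thus "x = y" by (simp add: sigma_pow_6)
qed

lemma cartan_commute: "cartan X i j = cartan X j i"
  by (auto simp: cartan_def)

definition adjacent :: "folding \<Rightarrow> nat \<Rightarrow> nat \<Rightarrow> bool" where
  "adjacent X i j \<longleftrightarrow> (i, j) \<in> edges X \<or> (j, i) \<in> edges X"

lemma adjacent_A_C:
  assumes "i \<in> verts (A_C l)" "j \<in> verts (A_C l)"
  shows "adjacent (A_C l) i j \<longleftrightarrow> j = i + 1 \<or> i = j + 1"
  using assms by (auto simp: adjacent_def verts_def)

lemma adjacent_D_B:
  assumes "l \<ge> 3"
  shows "adjacent (D_B l) i j \<longleftrightarrow>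
    j = i + 1 \<and> 1 \<le> i \<and> i < l \<or> i = j + 1 \<and> 1 \<le> j \<and> j < l \<or>
    i + 1 = l \<and> j = l + 1 \<or> j + 1 = l \<and> i = l + 1"
proof -
  \<comment> \<open>Writing \<open>l\<close> as a successor removes the truncated subtraction in the
    edge \<open>(l - 1, l + 1)\<close>.\<close>
  obtain k where "l = Suc k" using assms by (cases l) auto
  thus ?thesis by (auto simp: adjacent_def)
qed

text \<open>In type A the reflection reverses the chain; in type D it exchanges the two ends of the
  fork, both attached to \<open>l - 1\<close>; the exceptional diagrams are checked vertex by
  vertex.\<close>

lemma adjacent_sigma:
  assumes "valid_folding X" "i \<in> verts X" "j \<in> verts X"
  shows "adjacent X (sigma X i) (sigma X j) \<longleftrightarrow> adjacent X i j"
proof (cases X)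
  case (A_C l)
  have ij: "1 \<le> i" "i \<le> 2 * l - 1" "1 \<le> j" "j \<le> 2 * l - 1"
    using assms(2,3) by (auto simp: A_C verts_def)
  hence "sigma X i = 2 * l - i" "sigma X j = 2 * l - j" by (auto simp: A_C)
  moreover have "2 * l - i \<in> verts X" "2 * l - j \<in> verts X" using ij by (auto simp: A_C verts_def)
  ultimately show ?thesis using assms(2,3) ij unfolding A_C by (simp add: adjacent_A_C) arith
next
  case (D_B l)
  hence l: "l \<ge> 3" using assms(1) by simp
  show ?thesis unfolding D_B adjacent_D_B[OF l] using l by simp linarith
next
  case E6_F4
  have *: "x \<in> {1,2,3,4,5,6}" if "x \<in> verts X" for x using E6_F4 that by (auto simp: verts_def)
  show ?thesis using E6_F4 *[OF assms(2)] *[OF assms(3)] by (auto simp: adjacent_def)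
next
  case D4_G2
  have *: "x \<in> {1,2,3,4}" if "x \<in> verts X" for x using D4_G2 that by (auto simp: verts_def)
  show ?thesis using D4_G2 *[OF assms(2)] *[OF assms(3)] by (auto simp: adjacent_def)
qed

lemma cartan_sigma:
  assumes "valid_folding X" "i \<in> verts X" "j \<in> verts X"
  shows "cartan X (sigma X i) (sigma X j) = cartan X i j"
proof -
  have "sigma X i = sigma X j \<longleftrightarrow> i = j"
    using inj_sigma by (auto dest: injD)
  thus ?thesis using adjacent_sigma[OF assms] by (simp add: cartan_def adjacent_def)
qed

lemma cartan_sigma_funpow:
  assumes "valid_folding X" "i \<in> verts X" "j \<in> verts X"
  shows "cartan X ((sigma X ^^ k) i) ((sigma X ^^ k) j) = cartan X i j"
  by (induction k) (use assms in \<open>auto simp: cartan_sigma sigma_funpow_in_verts\<close>)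

text \<open>In type A the vertices \<open>i\<close> and \<open>2 * l - i\<close> have the same
  parity, hence are never consecutive. This is special to odd rank: reflecting a chain of even
  length swaps its two adjacent middle vertices.\<close>

lemma not_adjacent_sigma:
  assumes "valid_folding X" "i \<in> verts X"
  shows "\<not> adjacent X i (sigma X i)"
proof (cases X)
  case (A_C l)
  have i: "1 \<le> i" "i \<le> 2 * l - 1" using assms(2) by (auto simp: A_C verts_def)
  hence "sigma X i = 2 * l - i" by (auto simp: A_C)
  moreover have "2 * l - i \<in> verts X" using i by (auto simp: A_C verts_def)
  moreover have "2 * l - i \<noteq> i + 1" "i \<noteq> 2 * l - i + 1" using i by presburger+
  ultimately show ?thesis using assms(2) unfolding A_C by (simp add: adjacent_A_C)
next
  case (D_B l)
  hence l: "l \<ge> 3" using assms(1) by simp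
  show ?thesis unfolding D_B adjacent_D_B[OF l] using l by simp
qed (auto simp: adjacent_def)

text \<open>As the order is 2 or 3, an iterate is \<open>i\<close>, its image or its preimage; the
  absence of edges inside an orbit thus reduces to \<open>not_adjacent_sigma\<close>.\<close>

lemma sigma_funpow_cases: "(sigma X ^^ k) i \<in> {i, sigma X i} \<or> sigma X ((sigma X ^^ k) i) = i"
proof (induction k)
  case (Suc k)
  with sigma_order[of X] show ?case by auto
qed simp

lemma cartan_same_orbit:
  assumes "valid_folding X" "i \<in> verts X" "(sigma X ^^ k) i \<noteq> i"
  shows "cartan X i ((sigma X ^^ k) i) = 0"
proof -
  have "\<not> adjacent X i ((sigma X ^^ k) i)"
    using sigma_funpow_cases[of k X i] assms(3) not_adjacent_sigma[OF assms(1,2)]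
      not_adjacent_sigma[OF assms(1) sigma_funpow_in_verts[OF assms(1,2)], of k]
    by (auto simp: adjacent_def)
  with assms(3) show ?thesis by (simp add: cartan_def adjacent_def)
qed

section \<open>Orbits of vertices\<close>

lemma orbit_refl: "i \<in> orbit X i"
  unfolding orbit_def using funpow_0[of "sigma X" i, symmetric] by blast

lemma orbit_subset_verts: "valid_folding X \<Longrightarrow> i \<in> verts X \<Longrightarrow> orbit X i \<subseteq> verts X"
  unfolding orbit_def using sigma_funpow_in_verts by blast

lemma orbit_subset_orbit:
  assumes "j \<in> orbit X i"
  shows "orbit X j \<subseteq> orbit X i"
proof
  fix x assume "x \<in> orbit X j"
  then obtain k k' where "x = (sigma X ^^ k) ((sigma X ^^ k') i)" using assms by (auto simp: orbit_def)
  hence "x = (sigma X ^^ (k + k')) i" by (simp add: funpow_add)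
  thus "x \<in> orbit X i" unfolding orbit_def by blast
qed

text \<open>\<open>orbit\<close> collects forward iterates only. Since \<open>6 * k\<close> is a
  period, the iterate of order \<open>5 * k\<close> undoes the one of order \<open>k\<close>, which
  makes the relation symmetric.\<close>

lemma orbit_eq:
  assumes "j \<in> orbit X i"
  shows "orbit X j = orbit X i"
proof -
  obtain k where k: "j = (sigma X ^^ k) i" using assms by (auto simp: orbit_def)
  have per: "(sigma X ^^ (6 * n)) i = i" for n
  proof (induction n)
    case (Suc n)
    have "(sigma X ^^ (6 * Suc n)) i = (sigma X ^^ 6) ((sigma X ^^ (6 * n)) i)"
      by (simp only: mult_Suc_right funpow_add o_apply)
    with Suc show ?case by (simp only: sigma_pow_6)
  qed simp
  have "(sigma X ^^ (5 * k)) j = (sigma X ^^ (5 * k + k)) i"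
    unfolding k funpow_add o_apply ..
  also have "5 * k + k = 6 * k" by simp
  finally have "i \<in> orbit X j" unfolding orbit_def per by blast
  from orbit_subset_orbit[OF this] orbit_subset_orbit[OF assms] show ?thesis by (rule equalityI[rotated])
qed

section \<open>Vertices and Cartan matrix of the folded diagram\<close>

lemma finite_verts: "finite (verts X)" by (simp add: verts_def)

lemma folded_vertsD:
  assumes "valid_folding X" "a \<in> folded_verts X" "i \<in> a"
  shows "i \<in> verts X" "orbit X i = a"
proof -
  obtain k where k: "k \<in> verts X" "a = orbit X k" using assms(2) by (auto simp: folded_verts_def)
  show "i \<in> verts X" using orbit_subset_verts[OF assms(1) k(1)] assms(3) k(2) by auto
  show "orbit X i = a" using orbit_eq assms(3) k(2) by simp
qed

lemma finite_folded_vert: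
  assumes "valid_folding X" "a \<in> folded_verts X"
  shows "finite a"
  using folded_vertsD(1)[OF assms] by (intro finite_subset[OF _ finite_verts] subsetI)

text \<open>A power of \<open>sigma X\<close> carrying \<open>i\<close> to \<open>i'\<close>
  permutes \<open>b\<close> and preserves the Cartan matrix, so it reindexes one sum into the
  other.\<close>

lemma sum_cartan_orbit:
  assumes "valid_folding X" "a \<in> folded_verts X" "b \<in> folded_verts X" "i \<in> a" "i' \<in> a"
  shows "(\<Sum>j\<in>b. cartan X i j) = (\<Sum>j\<in>b. cartan X i' j)"
proof -
  have "i' \<in> orbit X i" using assms folded_vertsD(2) by blast
  then obtain k where k: "i' = (sigma X ^^ k) i" by (auto simp: orbit_def)
  note bD = folded_vertsD[OF assms(1,3)]
  have "bij_betw (sigma X ^^ k) b b"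
  proof -
    have fin: "finite b" by (rule finite_folded_vert[OF assms(1,3)])
    have "(sigma X ^^ k) ` b \<subseteq> b"
      using bD(2) unfolding orbit_def by blast
    moreover have "inj_on (sigma X ^^ k) b" using inj_fn[OF inj_sigma] by (rule inj_on_subset) simp
    ultimately show ?thesis using fin by (simp add: bij_betw_def endo_inj_surj)
  qed
  hence "(\<Sum>j\<in>b. cartan X i' j) = (\<Sum>j\<in>b. cartan X i' ((sigma X ^^ k) j))"
    by (rule sum.reindex_bij_betw[symmetric])
  also have "\<dots> = (\<Sum>j\<in>b. cartan X i j)"
    unfolding k using bD(1) folded_vertsD(1)[OF assms(1,2,4)]
    by (intro sum.cong refl cartan_sigma_funpow assms(1)) auto
  finally show ?thesis by simp
qed

text \<open>With \<open>S\<close> the common row sum, the form of \<open>b\<close> and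
  \<open>a\<close> is \<open>S / card b\<close>, and that of \<open>b\<close> with itself is
  \<open>2 / card b\<close> because distinct vertices of an orbit are orthogonal. The quotient is
  the integer \<open>S\<close>, so the floor loses nothing.\<close>

lemma folded_cartan_eq_sum:
  assumes "valid_folding X" "a \<in> folded_verts X" "b \<in> folded_verts X" "i \<in> a"
  shows "folded_cartan X b a = (\<Sum>j\<in>b. cartan X i j)"
proof -
  have fin: "finite c" "c \<noteq> {}" if "c \<in> folded_verts X" for c
  proof -
    show "finite c" by (rule finite_folded_vert[OF assms(1) that])
    show "c \<noteq> {}" using that orbit_refl unfolding folded_verts_def by blast
  qed
  define S where "S = (\<Sum>j\<in>b. cartan X i j)"
  have "(\<Sum>x\<in>b. \<Sum>y\<in>a. of_int (cartan X x y)) = (\<Sum>y\<in>a. \<Sum>x\<in>b. (of_int (cartan X y x) :: rat))"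
    by (subst sum.swap) (simp add: cartan_commute)
  also have "\<dots> = (\<Sum>y\<in>a. of_int S)"
  proof (rule sum.cong[OF refl])
    fix y assume "y \<in> a"
    hence "(\<Sum>x\<in>b. cartan X y x) = S" unfolding S_def by (rule sum_cartan_orbit[OF assms(1-3) _ assms(4)])
    thus "(\<Sum>x\<in>b. of_int (cartan X y x)) = (of_int S :: rat)" by (simp flip: of_int_sum)
  qed
  finally have ba: "folded_form X b a = of_int S / of_nat (card b)"
    using fin[OF assms(2)] by (simp add: folded_form_def)
  have "(\<Sum>y\<in>b. cartan X x y) = 2" if x: "x \<in> b" for x
  proof -
    have "cartan X x y = (if y = x then 2 else 0)" if "y \<in> b" for y
    proof (cases "y = x")
      case False
      have "y \<in> orbit X x" using that x folded_vertsD(2)[OF assms(1,3)] by blast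
      then obtain k where "y = (sigma X ^^ k) x" by (auto simp: orbit_def)
      with False show ?thesis using cartan_same_orbit[OF assms(1) folded_vertsD(1)[OF assms(1,3) x]] by auto
    qed (simp add: cartan_def)
    hence "(\<Sum>y\<in>b. cartan X x y) = (\<Sum>y\<in>b. if y = x then 2 else 0)" by (intro sum.cong) auto
    thus ?thesis using x fin(1)[OF assms(3)] by simp
  qed
  hence "(\<Sum>x\<in>b. \<Sum>y\<in>b. of_int (cartan X x y)) = (2 * of_nat (card b) :: rat)"
    by (simp flip: of_int_sum)
  hence bb: "folded_form X b b = 2 / of_nat (card b)"
    using fin[OF assms(3)] by (simp add: folded_form_def)
  have "2 * folded_form X b a / folded_form X b b = of_int S"
    unfolding ba bb using fin[OF assms(3)] by simp
  thus ?thesis by (simp only: folded_cartan_def floor_of_int flip: S_def)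
qed

lemma cartan_same_folded_vert:
  assumes "valid_folding X" "a \<in> folded_verts X" "i \<in> a" "j \<in> a" "j \<noteq> i"
  shows "cartan X i j = 0"
proof -
  have "j \<in> orbit X i" using assms folded_vertsD(2) by blast
  then obtain k where "j = (sigma X ^^ k) i" by (auto simp: orbit_def)
  thus ?thesis using cartan_same_orbit folded_vertsD(1) assms by blast
qed

text \<open>Off the diagonal a simply-laced Cartan matrix has entries 0 and -1 only, so the row sum
  counts neighbours.\<close>

lemma folded_cartan_eq_card:
  assumes "valid_folding X" "a \<in> folded_verts X" "b \<in> folded_verts X" "b \<noteq> a" "i \<in> a"
  shows "folded_cartan X b a = - int (card {j\<in>b. cartan X i j \<noteq> 0})"
proof -
  have fin: "finite b" by (rule finite_folded_vert[OF assms(1,3)])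
  have "i \<notin> b" using assms folded_vertsD(2) by blast
  hence "cartan X i j = (if cartan X i j \<noteq> 0 then -1 else 0)" if "j \<in> b" for j
    using that by (auto simp: cartan_def)
  hence "(\<Sum>j\<in>b. cartan X i j) = (\<Sum>j\<in>b. if cartan X i j \<noteq> 0 then -1 else 0)"
    by (intro sum.cong) auto
  also have "\<dots> = (\<Sum>j\<in>{j\<in>b. cartan X i j \<noteq> 0}. -1)"
    using fin by (intro sum.mono_neutral_cong_right) auto
  finally show ?thesis using folded_cartan_eq_sum[OF assms(1,2,3,5)] by simp
qed

text \<open>Groups the neighbours of \<open>i\<close> by orbit: none lies in the orbit of
  \<open>i\<close> itself, and orbits without neighbours contribute a power with exponent 0.\<close>

lemma prod_folded_neighbours:
  fixes g :: "nat \<Rightarrow> 'c::comm_monoid_mult"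
  assumes "valid_folding X" "a \<in> folded_verts X" "i \<in> a"
    and "\<And>b j. b \<in> folded_verts X \<Longrightarrow> j \<in> b \<Longrightarrow> g j = G b"
  shows "(\<Prod>j\<in>{j\<in>verts X - {i}. cartan X i j \<noteq> 0}. g j) =
    (\<Prod>b\<in>folded_verts X - {a}. G b ^ nat (- folded_cartan X b a))"
proof -
  let ?N = "{j\<in>verts X - {i}. cartan X i j \<noteq> 0}"
  have "orbit X j \<noteq> a" if "j \<in> ?N" for j
    using that orbit_refl[of j X] cartan_same_folded_vert[OF assms(1,2,3)] by auto
  hence "orbit X ` ?N \<subseteq> folded_verts X - {a}" by (auto simp: folded_verts_def)
  hence "(\<Prod>j\<in>?N. g j) = (\<Prod>b\<in>folded_verts X - {a}. \<Prod>j\<in>{j\<in>?N. orbit X j = b}. g j)"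
    by (intro prod.group[symmetric]) (auto simp: finite_verts folded_verts_def)
  also have "\<dots> = (\<Prod>b\<in>folded_verts X - {a}. G b ^ nat (- folded_cartan X b a))"
  proof (rule prod.cong[OF refl])
    fix b assume b: "b \<in> folded_verts X - {a}"
    have "i \<notin> b" using assms(2,3) b folded_vertsD(2)[OF assms(1)] by blast
    hence eq: "{j\<in>?N. orbit X j = b} = {j\<in>b. cartan X i j \<noteq> 0}"
      using b folded_vertsD[OF assms(1), of b] orbit_refl[of _ X] by blast
    have "(\<Prod>j\<in>{j\<in>b. cartan X i j \<noteq> 0}. g j) = (\<Prod>j\<in>{j\<in>b. cartan X i j \<noteq> 0}. G b)"
      using b assms(4) by (intro prod.cong) auto
    thus "(\<Prod>j\<in>{j\<in>?N. orbit X j = b}. g j) = G b ^ nat (- folded_cartan X b a)"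
      unfolding eq using folded_cartan_eq_card[OF assms(1,2) _ _ assms(3), of b] b by simp
  qed
  finally show ?thesis .
qed

section \<open>From the equations on vertices to the equations on orbits\<close>

lemma folded_bethe_equations_if_bethe_equations:
  assumes X: "valid_folding X" and be: "bethe_equations X q \<kappa> P m w"
    and id: "identified_roots X m w m' w'"
  shows "folded_bethe_equations X q \<kappa> P m' w'"
  unfolding folded_bethe_equations_def
proof (intro ballI)
  fix a i r assume a: "a \<in> folded_verts X" and i: "i \<in> a" and r: "r \<in> {1..m' a}"
  have "\<forall>j\<in>verts X. \<exists>\<pi>. bij_betw \<pi> {1..m j} {1..m j} \<and> (\<forall>r\<in>{1..m j}. w' (orbit X j) r = w j (\<pi> r))"
    using id by (simp add: identified_roots_def)
  then obtain \<pi> where \<pi>: "\<And>j. j \<in> verts X \<Longrightarrow> bij_betw (\<pi> j) {1..m j} {1..m j}"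
    "\<And>j r. j \<in> verts X \<Longrightarrow> r \<in> {1..m j} \<Longrightarrow> w' (orbit X j) r = w j (\<pi> j r)" by metis
  have m': "m' (orbit X j) = m j" if "j \<in> verts X" for j
    using that id by (simp add: identified_roots_def)
  note aD = folded_vertsD[OF X a i]
  have mm: "m' a = m i" using m'[OF aD(1)] aD(2) by simp
  \<comment> \<open>The equation of \<open>i\<close> is used at the root which the identification
    places at position \<open>r\<close> of the list of its orbit.\<close>
  define r0 where "r0 = \<pi> i r"
  have r0: "r0 \<in> {1..m i}" using \<pi>(1)[OF aD(1)] r mm unfolding r0_def by (auto simp: bij_betw_def)
  have wr: "w' a r = w i r0" using \<pi>(2)[OF aD(1)] r mm aD(2) by (simp add: r0_def)
  have bs: "bij_betw (\<pi> i) ({1..m' a} - {r}) ({1..m i} - {r0})"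
    using bij_betw_DiffI[OF \<pi>(1)[OF aD(1)], of "{r}" "{r0}"] r mm r0 by (simp add: r0_def bij_betw_def)
  have ws: "w' a s = w i (\<pi> i s)" if "s \<in> {1..m' a}" for s
    using \<pi>(2)[OF aD(1)] that mm aD(2) by simp
  from be aD(1) r0 have
    e1: "w i r0 \<noteq> 0" "poly (P i) (q / w i r0) \<noteq> 0"
    and e2: "\<And>s. s\<in>{1..m i} - {r0} \<Longrightarrow> w i r0 - w i s * q\<^sup>2 \<noteq> 0"
    and e3: "\<And>j s. j\<in>verts X - {i} \<Longrightarrow> cartan X i j \<noteq> 0 \<Longrightarrow> s\<in>{1..m j} \<Longrightarrow>
        w i r0 - w j s * q powi cartan X i j \<noteq> 0"
    and e4: "\<kappa> i * q ^ degree (P i) * (poly (P i) (inverse q / w i r0) / poly (P i) (q / w i r0)) =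
       - (\<Prod>s\<in>{1..m i} - {r0}. (w i r0 - w i s * q powi (-2)) / (w i r0 - w i s * q\<^sup>2)) *
         (\<Prod>j\<in>{j \<in> verts X - {i}. cartan X i j \<noteq> 0}. \<Prod>s=1..m j.
            (w i r0 - w j s * q powi (- cartan X i j)) / (w i r0 - w j s * q powi cartan X i j))"
    unfolding bethe_equations_def by blast+
  have c1: "\<forall>s\<in>{1..m' a} - {r}. w' a r - w' a s * q\<^sup>2 \<noteq> 0"
  proof
    fix s assume s: "s \<in> {1..m' a} - {r}"
    hence "\<pi> i s \<in> {1..m i} - {r0}" using bs by (auto simp: bij_betw_def)
    from e2[OF this] show "w' a r - w' a s * q\<^sup>2 \<noteq> 0" using s ws wr by simp
  qed
  have p1: "(\<Prod>s\<in>{1..m' a} - {r}. (w' a r - w' a s * q powi (-2)) / (w' a r - w' a s * q\<^sup>2)) =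
    (\<Prod>s\<in>{1..m i} - {r0}. (w i r0 - w i s * q powi (-2)) / (w i r0 - w i s * q\<^sup>2))"
    using ws wr by (subst prod.reindex_bij_betw[OF bs, symmetric]) (auto intro!: prod.cong)
  have adj: "cartan X i j = -1" if "j \<in> verts X - {i}" "cartan X i j \<noteq> 0" for j
    using that by (auto simp: cartan_def split: if_splits)
  have c2: "\<forall>b\<in>folded_verts X - {a}. \<forall>s\<in>{1..m' b}.
          (w' a r - w' b s * inverse q) powi (- folded_cartan X b a) \<noteq> 0"
  proof (intro ballI)
    fix b s assume b: "b \<in> folded_verts X - {a}" and s: "s \<in> {1..m' b}"
    show "(w' a r - w' b s * inverse q) powi (- folded_cartan X b a) \<noteq> 0"
    proof (cases "{j\<in>b. cartan X i j \<noteq> 0} = {}")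
      case True
      \<comment> \<open>Without a neighbour of \<open>i\<close> in \<open>b\<close> the exponent is
        0, and the power is 1 even where its base vanishes.\<close>
      have "folded_cartan X b a = 0"
        using b folded_cartan_eq_card[OF X a _ _ i, of b] unfolding True by simp
      thus ?thesis by simp
    next
      case False
      then obtain j where j: "j \<in> b" "cartan X i j \<noteq> 0" by blast
      have jD: "j \<in> verts X" "orbit X j = b" using folded_vertsD[OF X _ j(1)] b by auto
      have ji: "j \<noteq> i" using b jD(2) aD(2) by auto
      have s': "\<pi> j s \<in> {1..m j}" "w' b s = w j (\<pi> j s)"
        using \<pi>[OF jD(1)] s m'[OF jD(1)] jD(2) by (auto simp: bij_betw_def)
      show ?thesis using e3[OF _ j(2) s'(1)] jD(1) ji adj[OF _ j(2)] wr s'(2) by (simp add: power_int_minus)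
    qed
  qed
  \<comment> \<open>As \<open>cartan X i j = -1\<close> for every neighbour, its factor depends on
    \<open>j\<close> only through the root, hence only on the orbit after identification.\<close>
  define h where "h x = (w' a r - x * q) / (w' a r - x * inverse q)" for x
  have "(\<Prod>j\<in>{j \<in> verts X - {i}. cartan X i j \<noteq> 0}. \<Prod>s=1..m j.
            (w i r0 - w j s * q powi (- cartan X i j)) / (w i r0 - w j s * q powi cartan X i j)) =
    (\<Prod>j\<in>{j \<in> verts X - {i}. cartan X i j \<noteq> 0}. \<Prod>s=1..m j. h (w j s))"
  proof (intro prod.cong refl)
    fix j s assume "j \<in> {j \<in> verts X - {i}. cartan X i j \<noteq> 0}"
    hence "cartan X i j = -1" using adj by blast
    thus "(w i r0 - w j s * q powi (- cartan X i j)) / (w i r0 - w j s * q powi cartan X i j) = h (w j s)"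
      by (simp add: h_def wr power_int_minus)
  qed
  also have "\<dots> = (\<Prod>b\<in>folded_verts X - {a}. (\<Prod>s=1..m' b. h (w' b s)) ^ nat (- folded_cartan X b a))"
  proof (rule prod_folded_neighbours[OF X a i])
    fix b j assume b: "b \<in> folded_verts X" "j \<in> b"
    have jD: "j \<in> verts X" "orbit X j = b" using folded_vertsD[OF X b] by auto
    show "(\<Prod>s=1..m j. h (w j s)) = (\<Prod>s=1..m' b. h (w' b s))"
      using \<pi>(2)[OF jD(1)] m'[OF jD(1)] jD(2)
      by (subst prod.reindex_bij_betw[OF \<pi>(1)[OF jD(1)], symmetric]) (auto intro!: prod.cong)
  qed
  also have "\<dots> = (\<Prod>b\<in>folded_verts X - {a}. \<Prod>s=1..m' b.
            (w' a r - w' b s * q) powi (- folded_cartan X b a) /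
            (w' a r - w' b s * inverse q) powi (- folded_cartan X b a))"
  proof (intro prod.cong refl)
    fix b assume b: "b \<in> folded_verts X - {a}"
    \<comment> \<open>A nonnegative exponent turns the integer power into a natural one, which
      distributes over the product and the quotient.\<close>
    have "- folded_cartan X b a \<ge> 0" using folded_cartan_eq_card[OF X a _ _ i, of b] b by simp
    thus "(\<Prod>s=1..m' b. h (w' b s)) ^ nat (- folded_cartan X b a) = (\<Prod>s=1..m' b.
            (w' a r - w' b s * q) powi (- folded_cartan X b a) /
            (w' a r - w' b s * inverse q) powi (- folded_cartan X b a))"
      by (simp add: h_def power_int_def power_divide[symmetric] prod_power_distrib)
  qed
  finally show "w' a r \<noteq> 0 \<and> poly (P i) (q / w' a r) \<noteq> 0 \<and>
       (\<forall>s\<in>{1..m' a} - {r}. w' a r - w' a s * q\<^sup>2 \<noteq> 0) \<and>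
       (\<forall>b\<in>folded_verts X - {a}. \<forall>s\<in>{1..m' b}.
          (w' a r - w' b s * inverse q) powi (- folded_cartan X b a) \<noteq> 0) \<and>
       \<kappa> i * q ^ degree (P i) * (poly (P i) (inverse q / w' a r) / poly (P i) (q / w' a r)) =
       - (\<Prod>s\<in>{1..m' a} - {r}. (w' a r - w' a s * q powi (-2)) / (w' a r - w' a s * q\<^sup>2)) *
         (\<Prod>b\<in>folded_verts X - {a}. \<Prod>s=1..m' b.
            (w' a r - w' b s * q) powi (- folded_cartan X b a) /
            (w' a r - w' b s * inverse q) powi (- folded_cartan X b a))"
    using e1 e4 c1 c2 p1 by (simp add: wr)
qed

section \<open>The kernel of the deformed Cartan matrix\<close>

definition neighbours :: "folding \<Rightarrow> nat \<Rightarrow> nat set" where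
  "neighbours X i = {j \<in> verts X. cartan X i j = -1}"

lemma neighbours_eq: "neighbours X i = {j \<in> verts X. j \<noteq> i \<and> adjacent X i j}"
  by (auto simp: neighbours_def cartan_def adjacent_def)

lemma neighbours_sigma:
  assumes "valid_folding X" "i \<in> verts X"
  shows "neighbours X (sigma X i) = sigma X ` neighbours X i"
proof
  have surj: "sigma X ` verts X = verts X"
    using assms(1) sigma_in_verts by (intro endo_inj_surj finite_verts inj_on_subset[OF inj_sigma]) auto
  show "neighbours X (sigma X i) \<subseteq> sigma X ` neighbours X i"
  proof
    fix j assume j: "j \<in> neighbours X (sigma X i)"
    hence "j \<in> sigma X ` verts X" unfolding surj by (simp add: neighbours_def)
    then obtain j' where "j' \<in> verts X" "j = sigma X j'" by blast
    thus "j \<in> sigma X ` neighbours X i" using j assms by (auto simp: neighbours_def cartan_sigma)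
  qed
  show "sigma X ` neighbours X i \<subseteq> neighbours X (sigma X i)"
    using assms by (auto simp: neighbours_def cartan_sigma sigma_in_verts)
qed

lemma neighbours_A_C:
  assumes "1 \<le> i" "i \<le> 2 * l - 1"
  shows "neighbours (A_C l) i = (if i = 1 then {} else {i - 1}) \<union> (if i = 2 * l - 1 then {} else {i + 1})"
proof -
  have i: "i \<in> verts (A_C l)" using assms by (simp add: verts_def)
  have "neighbours (A_C l) i = {j \<in> verts (A_C l). j = i + 1 \<or> i = j + 1}"
    unfolding neighbours_eq using adjacent_A_C[OF i] by auto
  moreover have "j \<in> verts (A_C l) \<and> (j = i + 1 \<or> i = j + 1) \<longleftrightarrow>
      i \<noteq> 1 \<and> j = i - 1 \<or> i \<noteq> 2 * l - 1 \<and> j = i + 1" for j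
    unfolding verts_def atLeastAtMost_iff rk.simps using assms by linarith
  ultimately show ?thesis by simp blast
qed

text \<open>The recurrence from the end of the chain makes \<open>d i\<close> the quantum integer of
  \<open>i\<close> at \<open>x\<close> times \<open>d 1\<close>. Antisymmetry forces
  \<open>d l = 0\<close> at the midpoint, and the quantum integer of \<open>l\<close> is nonzero, so
  \<open>d 1 = 0\<close>.\<close>

lemma kernel_A_C:
  fixes d :: "nat \<Rightarrow> complex"
  assumes x: "x \<noteq> 0" "\<And>n. n > 0 \<Longrightarrow> x ^ n \<noteq> 1"
    and d: "\<And>i. 1 \<le> i \<Longrightarrow> i \<le> 2 * l - 1 \<Longrightarrow> (x + 1 / x) * d i = (\<Sum>j\<in>neighbours (A_C l) i. d j)"
    and sym: "\<And>i. 1 \<le> i \<Longrightarrow> i \<le> 2 * l - 1 \<Longrightarrow> d (2 * l - i) = - d i"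
    and i: "1 \<le> i" "i \<le> 2 * l - 1"
  shows "d i = 0"
proof -
  have rec: "d (Suc i) = (x + 1 / x) * d i - (if i = 1 then 0 else d (i - 1))" if "1 \<le> i" "i < 2 * l - 1" for i
    using d[of i] that by (simp add: neighbours_A_C)
  have x2: "x - 1 / x \<noteq> 0" using x(2)[of 2] x(1) by (auto simp: field_simps power2_eq_square)
  have eq: "(x - 1 / x) * d i = (x ^ i - (1 / x) ^ i) * d 1" if "1 \<le> i" "i \<le> 2 * l - 1" for i
    using that
  proof (induction i rule: less_induct)
    case (less i)
    show ?case
    proof (cases "i = 1")
      case False
      then obtain k where k: "i = Suc k" "k \<ge> 1" using less.prems(1) by (cases i) auto
      have r: "d i = (x + 1 / x) * d k - (if k = 1 then 0 else d (k - 1))"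
        using rec[of k] k less.prems by simp
      have IH: "(x - 1 / x) * d k = (x ^ k - (1 / x) ^ k) * d 1"
        using less.IH[of k] k less.prems by simp
      \<comment> \<open>For \<open>k = 1\<close> both sides vanish: the missing vertex 0 fits the
        formula with value 0.\<close>
      have IH': "(x - 1 / x) * (if k = 1 then 0 else d (k - 1)) = (x ^ (k - 1) - (1 / x) ^ (k - 1)) * d 1"
        using less.IH[of "k - 1"] k less.prems by auto
      have "(x - 1 / x) * d i = (x + 1 / x) * ((x - 1 / x) * d k) - (x - 1 / x) * (if k = 1 then 0 else d (k - 1))"
        unfolding r by (simp only: right_diff_distrib mult.left_commute)
      also have "\<dots> = ((x + 1 / x) * (x ^ k - (1 / x) ^ k) - (x ^ (k - 1) - (1 / x) ^ (k - 1))) * d 1"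
        unfolding IH IH' by (simp only: left_diff_distrib mult.assoc)
      also obtain k' where k': "k = Suc k'" using k by (cases k) auto
      have "(x + 1 / x) * (x ^ k - (1 / x) ^ k) - (x ^ (k - 1) - (1 / x) ^ (k - 1)) = x ^ i - (1 / x) ^ i"
        unfolding k(1) k' diff_Suc_1 power_one_over using x(1) by (simp add: field_simps)
      finally show ?thesis .
    qed simp
  qed
  have "l \<ge> 1" using i by linarith
  hence l: "1 \<le> l" "l \<le> 2 * l - 1" by auto
  have "2 * l - l = l" by simp
  with sym[OF l] have "d l = 0" by simp
  hence "(x ^ l - (1 / x) ^ l) * d 1 = 0" using eq[OF l] by simp
  \<comment> \<open>Clearing denominators reduces nonvanishing of the factor to
    \<open>x ^ (2 * l)\<close> being different from 1.\<close>
  moreover have "x ^ l * (x ^ l - (1 / x) ^ l) = x ^ (2 * l) - 1"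
    using x(1) by (simp add: right_diff_distrib mult_2 power_add flip: power_mult_distrib)
  hence "x ^ l - (1 / x) ^ l \<noteq> 0"
    using x(2)[of "2 * l"] l(1) by auto
  ultimately have "d 1 = 0" by simp
  thus ?thesis using eq[OF i] x2 by simp
qed

text \<open>
  The deformed Cartan matrix is invertible for all types when \<open>x\<close> is not a root of unity, but only
  its kernel on vectors \<open>d = a - a \<circ> \<sigma>\<close> is needed. For \<open>\<sigma>\<close> of order 2 these are antisymmetric, and
  vanish at fixed vertices; for \<open>D_4\<close> the hypothesis only says that \<open>d\<close> vanishes at the central vertex.
\<close>

lemma kernel_deformed_cartan:
  fixes d :: "nat \<Rightarrow> complex"
  assumes X: "valid_folding X"
    and x: "x \<noteq> 0" "\<And>n. n > 0 \<Longrightarrow> x ^ n \<noteq> 1"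
    and d: "\<And>i. i \<in> verts X \<Longrightarrow> (x + 1 / x) * d i = (\<Sum>j\<in>neighbours X i. d j)"
    and sym2: "\<And>i. i \<in> verts X \<Longrightarrow> sigma X (sigma X i) = i \<Longrightarrow> d (sigma X i) = - d i"
    and i: "i \<in> verts X"
  shows "d i = 0"
proof -
  have t0: "x + 1 / x \<noteq> 0"
  proof
    assume "x + 1 / x = 0"
    hence "x * (x + 1 / x) = 0" by simp
    hence "x ^ 2 + 1 = 0" using x(1) by (simp add: distrib_left power2_eq_square)
    moreover have "x ^ 4 - 1 = (x ^ 2 + 1) * (x ^ 2 - 1)" by algebra
    ultimately have "x ^ 4 = 1" by simp
    thus False using x(2)[of 4] by simp
  qed
  have fix0: "d i = 0" if "i \<in> verts X" "sigma X i = i" for i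
    using sym2[of i] that by simp
  show ?thesis
  proof (cases X)
    case (A_C l)
    have sigma_order_2: "sigma X (sigma X i) = i" for i by (auto simp: A_C)
    show ?thesis
    proof (rule kernel_A_C[OF x])
      fix i assume i: "1 \<le> i" "i \<le> 2 * l - 1"
      hence "i \<in> verts X" by (simp add: A_C verts_def)
      thus "(x + 1 / x) * d i = (\<Sum>j\<in>neighbours (A_C l) i. d j)" using d A_C by blast
      show "d (2 * l - i) = - d i" using sym2[OF \<open>i \<in> verts X\<close>] sigma_order_2[of i] i by (simp add: A_C)
    qed (use i in \<open>auto simp: A_C verts_def\<close>)
  next
    case (D_B l)
    hence l: "l \<ge> 3" using X by simp
    have 0: "d i = 0" if "i \<in> verts X" "i \<noteq> l" "i \<noteq> l + 1" for i
      using fix0 that by (simp add: D_B)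
    \<comment> \<open>The ends \<open>l\<close> and \<open>l + 1\<close> of the fork have the single
      neighbour \<open>l - 1\<close>, a fixed vertex, where \<open>d\<close> vanishes.\<close>
    have "(\<Sum>j\<in>neighbours X i. d j) = 0" if "i = l \<or> i = l + 1"
    proof (rule sum.neutral, rule ballI)
      fix j assume "j \<in> neighbours X i"
      hence j: "j \<in> verts X" "adjacent X i j" by (auto simp: neighbours_eq)
      from j(2) have "j \<noteq> l" "j \<noteq> l + 1" using that l unfolding D_B adjacent_D_B[OF l] by auto
      thus "d j = 0" using 0 j by blast
    qed
    hence "i = l \<or> i = l + 1 \<Longrightarrow> d i = 0" using d[OF i] t0 by simp
    thus ?thesis using 0 i by blast
  next
    case E6_F4
    have v: "i \<in> verts X \<longleftrightarrow> i \<in> {1, 2, 3, 4, 5, 6}" for i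
      unfolding verts_def E6_F4 by (simp; presburger)
    have nb: "neighbours X 1 = {3}" "neighbours X 3 = {1, 4}"
      unfolding neighbours_eq v by (auto simp: adjacent_def E6_F4)
    \<comment> \<open>Vanishing at the fixed vertices 2 and 4 cuts off the leg with vertices 1 and
      3, leaving the deformed Cartan matrix of type A of rank 2, with determinant
      \<open>t ^ 2 - 1\<close>.\<close>
    have 0: "d 2 = 0" "d 4 = 0" using fix0 v by (auto simp: E6_F4)
    have neg: "d 6 = - d 1" "d 5 = - d 3" using sym2[of 1] sym2[of 3] v by (auto simp: E6_F4)
    define t where "t = x + 1 / x"
    have xt: "x * t = x ^ 2 + 1" unfolding t_def using x(1) by (simp add: distrib_left power2_eq_square)
    have e: "t * d 1 = d 3" "t * d 3 = d 1"
      using d[of 1] d[of 3] v nb 0 by (auto simp: t_def)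
    have "(t ^ 2 - 1) * d 1 = t * (t * d 1) - d 1" by algebra
    also have "\<dots> = 0" unfolding e by simp
    finally have "(t ^ 2 - 1) * d 1 = 0" .
    moreover have "t ^ 2 - 1 \<noteq> 0"
    proof
      assume *: "t ^ 2 - 1 = 0"
      \<comment> \<open>\<open>x ^ 2 * (t ^ 2 - 1)\<close> is \<open>x ^ 4 + x ^ 2 + 1\<close>, a
        factor of \<open>x ^ 6 - 1\<close>.\<close>
      have "x ^ 6 - 1 = (x ^ 2 - 1) * ((x ^ 2 + 1) ^ 2 - x ^ 2)" by algebra
      also have "\<dots> = (x ^ 2 - 1) * (x ^ 2 * (t ^ 2 - 1))" unfolding xt[symmetric] by algebra
      finally have "x ^ 6 = 1" unfolding * by simp
      thus False using x(2)[of 6] by simp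
    qed
    ultimately have "d 1 = 0" by simp
    thus ?thesis using e neg 0 i v by auto
  next
    case D4_G2
    have v: "i \<in> verts X \<longleftrightarrow> i \<in> {1, 2, 3, 4}" for i
      unfolding verts_def D4_G2 by (simp; presburger)
    have d2: "d 2 = 0" using fix0[of 2] v by (simp add: D4_G2)
    \<comment> \<open>An outer vertex has the central one as its only neighbour, so its equation
      reads \<open>(x + 1 / x) * d i = 0\<close>.\<close>
    have "j = 2" if "i \<noteq> 2" "j \<in> neighbours X i" for j
      using that by (auto simp: neighbours_eq D4_G2 adjacent_def)
    hence "(\<Sum>j\<in>neighbours X i. d j) = 0" if "i \<noteq> 2"
      using that d2 by (intro sum.neutral) blast
    thus ?thesis using d[OF i] d2 t0 by (cases "i = 2") auto
  qed
qed

section \<open>Invariance of the prefactors, and identification of the roots\<close>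

text \<open>With constant terms 1, the discrepancy \<open>c\<close> at order \<open>n\<close>
  behaves like a variation of the logarithm: products add it, and dilation by \<open>a\<close>
  scales it by \<open>a ^ n\<close>. The value 0 is allowed.\<close>

definition fps_first_diff ::
  "nat \<Rightarrow> complex fps \<Rightarrow> complex fps \<Rightarrow> complex \<Rightarrow> bool" where
  "fps_first_diff n F G c \<longleftrightarrow> fps_nth F 0 = 1 \<and> fps_nth G 0 = 1 \<and>
    (\<forall>k<n. fps_nth F k = fps_nth G k) \<and> fps_nth F n - fps_nth G n = c"

lemma fps_nth_mult_low:
  fixes A B :: "'a::comm_semiring_1 fps"
  assumes "\<And>k. k < n \<Longrightarrow> fps_nth A k = 0" "fps_nth B 0 = 1" "k \<le> n"
  shows "fps_nth (A * B) k = fps_nth A k"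
proof -
  have "fps_nth (A * B) k = (\<Sum>i=0..k. if i = k then fps_nth A k else 0)"
    unfolding fps_mult_nth using assms by (intro sum.cong) auto
  thus ?thesis by simp
qed

text \<open>Telescoping: \<open>F * F' - G * G' = (F - G) * F' + (F' - G') * G\<close>, where each
  difference starts at order \<open>n\<close> or later and each cofactor has constant term
  1.\<close>

lemma fps_first_diff_mult:
  assumes "fps_first_diff n F G c" "fps_first_diff n F' G' c'"
  shows "fps_first_diff n (F * F') (G * G') (c + c')"
proof -
  have *: "fps_nth (F * F') k - fps_nth (G * G') k =
      (fps_nth F k - fps_nth G k) + (fps_nth F' k - fps_nth G' k)" if "k \<le> n" for k
  proof -
    have "fps_nth ((F - G) * F') k = fps_nth (F - G) k"
      using assms that by (intro fps_nth_mult_low[of n]) (auto simp: fps_first_diff_def)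
    moreover have "fps_nth ((F' - G') * G) k = fps_nth (F' - G') k"
      using assms that by (intro fps_nth_mult_low[of n]) (auto simp: fps_first_diff_def)
    moreover have "F * F' - G * G' = (F - G) * F' + (F' - G') * G" by (simp add: algebra_simps)
    hence "fps_nth (F * F') k - fps_nth (G * G') k = fps_nth ((F - G) * F') k + fps_nth ((F' - G') * G) k"
      by (metis fps_add_nth fps_sub_nth)
    ultimately show ?thesis by simp
  qed
  have "fps_nth (F * F') k = fps_nth (G * G') k" if "k < n" for k
    using *[of k] that assms by (simp add: fps_first_diff_def)
  thus ?thesis using *[of n] assms by (simp add: fps_first_diff_def)
qed

lemma fps_first_diff_refl: "fps_nth F 0 = 1 \<Longrightarrow> fps_first_diff n F F 0"
  by (simp add: fps_first_diff_def)

lemma fps_first_diff_prod: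
  assumes "\<And>j. j \<in> A \<Longrightarrow> fps_first_diff n (F j) (G j) (c j)"
  shows "fps_first_diff n (\<Prod>j\<in>A. F j) (\<Prod>j\<in>A. G j) (\<Sum>j\<in>A. c j)"
  using assms
  by (induction A rule: infinite_finite_induct) (auto intro: fps_first_diff_mult fps_first_diff_refl)

lemma fps_first_diff_dilate:
  "fps_first_diff n F G c \<Longrightarrow> fps_first_diff n (fps_dilate a F) (fps_dilate a G) (a ^ n * c)"
  by (auto simp: fps_first_diff_def fps_dilate_def right_diff_distrib)

text \<open>Induction on the order \<open>n\<close>. The functional equations at \<open>i\<close>
  and \<open>sigma X i\<close> have the same source term \<open>R\<close>, so comparing them at
  order \<open>n\<close> gives the kernel equation at \<open>x = q ^ n\<close> for the discrepancies
  \<open>d\<close>.\<close>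

lemma baxter_prefactors_sigma:
  assumes X: "valid_folding X"
    and q: "q \<noteq> 0" "\<And>n. n > 0 \<Longrightarrow> q ^ n \<noteq> 1"
    and f: "baxter_prefactors X q P f"
    and P0: "\<And>i. i \<in> verts X \<Longrightarrow> P i \<noteq> 0"
    and P: "\<And>i. i \<in> verts X \<Longrightarrow> P (sigma X i) = P i"
    and i: "i \<in> verts X"
  shows "f (sigma X i) = f i"
proof -
  have f0: "fps_nth (f i) 0 = 1" if "i \<in> verts X" for i
    using f that by (simp add: baxter_prefactors_def)
  define R where "R i = fps_of_poly (smult (1 / lead_coeff (P i)) (reflect_poly (P i)))" for i
  \<comment> \<open>The reversed polynomial has constant term \<open>lead_coeff (P i)\<close>, which
    the scalar normalizes to 1.\<close>
  have R0: "fps_nth (R i) 0 = 1" if "i \<in> verts X" for i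
    using P0[OF that] by (simp add: R_def)
  have eq: "fps_dilate q (f i) * fps_dilate (1 / q) (f i) * R i = (\<Prod>j\<in>neighbours X i. f j)"
    if "i \<in> verts X" for i
    using f that by (simp add: baxter_prefactors_def R_def neighbours_def)
  have nb: "neighbours X i \<subseteq> verts X" for i by (auto simp: neighbours_def)
  note sv = sigma_in_verts[OF X]
  have "\<forall>i\<in>verts X. fps_nth (f i) n = fps_nth (f (sigma X i)) n" for n
  proof (induction n rule: less_induct)
    case (less n)
    define d where "d i = fps_nth (f i) n - fps_nth (f (sigma X i)) n" for i
    show ?case
    proof (cases "n = 0")
      \<comment> \<open>Order 0 is settled by the normalization; the kernel argument cannot start
        there, as \<open>q ^ 0 = 1\<close>.\<close>
      case True
      thus ?thesis using f0 sv by simp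
    next
      case False
      have df: "fps_first_diff n (f i) (f (sigma X i)) (d i)" if "i \<in> verts X" for i
        using less that f0 sv by (simp add: fps_first_diff_def d_def)
      have "d i = 0" if "i \<in> verts X" for i
      proof (rule kernel_deformed_cartan[OF X, of "q ^ n"])
        show "q ^ n \<noteq> 0" using q(1) by simp
        show "(q ^ n) ^ k \<noteq> 1" if "k > 0" for k
          using q(2)[of "n * k"] that False by (simp add: power_mult)
        fix i assume i: "i \<in> verts X"
        have "fps_first_diff n (fps_dilate q (f i) * fps_dilate (1 / q) (f i) * R i)
          (fps_dilate q (f (sigma X i)) * fps_dilate (1 / q) (f (sigma X i)) * R (sigma X i))
          ((q ^ n * d i + (1 / q) ^ n * d i) + 0)"
        proof (intro fps_first_diff_mult fps_first_diff_dilate df i)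
          have "R (sigma X i) = R i" using P[OF i] by (simp add: R_def)
          thus "fps_first_diff n (R i) (R (sigma X i)) 0" using R0[OF i] by (simp add: fps_first_diff_refl)
        qed
        moreover have "fps_first_diff n (\<Prod>j\<in>neighbours X i. f j) (\<Prod>j\<in>neighbours X i. f (sigma X j))
          (\<Sum>j\<in>neighbours X i. d j)"
          using nb df by (intro fps_first_diff_prod) blast
        moreover have "(\<Prod>j\<in>neighbours X i. f (sigma X j)) = (\<Prod>j\<in>neighbours X (sigma X i). f j)"
          unfolding neighbours_sigma[OF X i]
          by (subst prod.reindex) (auto intro: inj_on_subset[OF inj_sigma])
        ultimately have "q ^ n * d i + (1 / q) ^ n * d i = (\<Sum>j\<in>neighbours X i. d j)"
          unfolding eq[OF i] eq[OF sv[OF i]] by (simp add: fps_first_diff_def)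
        thus "(q ^ n + 1 / q ^ n) * d i = (\<Sum>j\<in>neighbours X i. d j)"
          by (simp add: distrib_right power_one_over)
        show "d (sigma X i) = - d i" if "sigma X (sigma X i) = i" using that by (simp add: d_def)
      qed (use that in auto)
      thus ?thesis by (simp add: d_def)
    qed
  qed
  thus ?thesis using i by (simp add: fps_eq_iff)
qed

text \<open>Both lists enumerate the multiset \<open>proots B\<close>: its size fixes the length,
  and equal image multisets differ by a permutation of the indices.\<close>

lemma lists_roots_unique:
  assumes "lists_roots B m w" "lists_roots B m' w'"
  shows "m' = m" "\<exists>\<pi>. bij_betw \<pi> {1..m} {1..m} \<and> (\<forall>r\<in>{1..m}. w' r = w (\<pi> r))"
proof -
  have roots: "proots B = image_mset w (mset_set {1..m})" if "lists_roots B m w" for m w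
  proof -
    obtain c where c: "c \<noteq> 0" "B = smult c (\<Prod>r=1..m. [:- w r, 1:])"
      using \<open>lists_roots B m w\<close> by (auto simp: lists_roots_def)
    have "proots (\<Prod>r\<in>A. [:- w r, 1:]) = image_mset w (mset_set A)" if "finite A" for A :: "nat set"
      using that
    proof (induction A rule: finite_induct)
      case (insert x A)
      have "(\<Prod>r\<in>A. [:- w r, 1:]) \<noteq> 0" using insert.hyps by simp
      hence "proots ([:- w x, 1:] * (\<Prod>r\<in>A. [:- w r, 1:])) =
          proots [:- w x, 1:] + proots (\<Prod>r\<in>A. [:- w r, 1:])" by (intro proots_mult) auto
      with insert show ?case by simp
    qed simp
    thus ?thesis using c by simp
  qed
  have eq: "image_mset w' (mset_set {1..m'}) = image_mset w (mset_set {1..m})"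
    using roots[OF assms(1)] roots[OF assms(2)] by simp
  hence "size (image_mset w' (mset_set {1..m'})) = size (image_mset w (mset_set {1..m}))" by simp
  thus m: "m' = m" by simp
  obtain \<pi> where "\<pi> permutes {1..m}" "\<forall>r\<in>{1..m}. w' r = w (\<pi> r)"
    using image_mset_eq_implies_permutes[of "{1..m}" w' w] eq m by auto
  thus "\<exists>\<pi>. bij_betw \<pi> {1..m} {1..m} \<and> (\<forall>r\<in>{1..m}. w' r = w (\<pi> r))"
    using permutes_imp_bij by blast
qed

text \<open>Each orbit takes the list of a chosen representative. As \<open>B\<close> is constant
  along the orbit, the list of any other element is a reordering of it.\<close>

lemma ex_identified_roots:
  assumes X: "valid_folding X"
    and B: "\<And>j. j \<in> verts X \<Longrightarrow> B (sigma X j) = B j"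
    and w: "\<And>j. j \<in> verts X \<Longrightarrow> lists_roots (B j) (m j) (w j)"
  shows "\<exists>m' w'. identified_roots X m w m' w'"
proof -
  define rep where "rep a = (SOME i. i \<in> a)" for a :: "nat set"
  have Bk: "B ((sigma X ^^ k) j) = B j" if "j \<in> verts X" for j k
    by (induction k) (use that B sigma_funpow_in_verts[OF X] in auto)
  have "identified_roots X m w (\<lambda>a. m (rep a)) (\<lambda>a. w (rep a))"
    unfolding identified_roots_def
  proof
    fix j assume j: "j \<in> verts X"
    have r: "rep (orbit X j) \<in> orbit X j" unfolding rep_def using orbit_refl by (rule someI)
    hence "rep (orbit X j) \<in> verts X" using folded_vertsD(1)[OF X _ r] j by (simp add: folded_verts_def)
    moreover have "B (rep (orbit X j)) = B j" using r Bk[OF j] by (auto simp: orbit_def)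
    ultimately have "lists_roots (B j) (m (rep (orbit X j))) (w (rep (orbit X j)))" using w by fastforce
    from lists_roots_unique[OF w[OF j] this]
    show "m (rep (orbit X j)) = m j \<and> (\<exists>\<pi>. bij_betw \<pi> {1..m j} {1..m j} \<and>
        (\<forall>r\<in>{1..m j}. w (rep (orbit X j)) r = w j (\<pi> r)))" by blast
  qed
  thus ?thesis by blast
qed

section \<open>Generalized eigenspaces and semi-simplification\<close>

definition gen_eigenspace :: "('a \<Rightarrow> 'b \<Rightarrow> 'b) \<Rightarrow> ('b \<Rightarrow> 'b) \<Rightarrow> 'a \<Rightarrow> 'b::ab_group_add set" where
  "gen_eigenspace s A c = {w. \<exists>k. ((\<lambda>x. A x - s c x) ^^ k) w = 0}"

section \<open>Direct sums of subspaces and linear maps defined on them\<close>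

context vector_space
begin

lemma linear_funpow: "Vector_Spaces.linear scale scale A \<Longrightarrow> Vector_Spaces.linear scale scale (A ^^ k)"
  by (induction k) (auto simp: Vector_Spaces.linear_iff vector_space_axioms)

text \<open>Common criterion for generalized eigenspaces and weight spaces. Applying
  \<open>D\<close> to a relation kills the summand at \<open>d\<close> and keeps the others in
  place, so induction on the number of summands applies. \<open>D\<close> may depend on
  \<open>x\<close>, since a nilpotency exponent may.\<close>

lemma direct_sum_if_separated:
  fixes E :: "'i \<Rightarrow> 'b set"
  assumes sep: "\<And>c d x. c \<in> I \<Longrightarrow> d \<in> I \<Longrightarrow> c \<noteq> d \<Longrightarrow> x \<in> E d \<Longrightarrow>
      \<exists>D. Vector_Spaces.linear scale scale D \<and> (\<forall>e\<in>I. D ` E e \<subseteq> E e) \<and> D x = 0 \<and> (\<forall>y\<in>E c. D y = 0 \<longrightarrow> y = 0)"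
    and "finite F" "F \<subseteq> I" "\<And>c. c \<in> F \<Longrightarrow> x c \<in> E c" "(\<Sum>c\<in>F. x c) = 0" "c \<in> F"
  shows "x c = 0"
  using assms(2-)
proof (induction F arbitrary: x c rule: finite_induct)
  case (insert d F)
  have zero: "x c = 0" if c: "c \<in> F" for c
  proof -
    have "c \<noteq> d" using c insert.hyps by blast
    with sep[of c d "x d"] insert.prems c obtain D where
      D: "Vector_Spaces.linear scale scale D" "\<And>e. e \<in> I \<Longrightarrow> D ` E e \<subseteq> E e" "D (x d) = 0"
        "\<And>y. y \<in> E c \<Longrightarrow> D y = 0 \<Longrightarrow> y = 0"
      by (metis insertCI subsetD)
    interpret D: Vector_Spaces.linear scale scale D by fact
    have "0 = D (\<Sum>c\<in>insert d F. x c)" unfolding insert.prems(3) by simp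
    also have "\<dots> = (\<Sum>c\<in>F. D (x c))"
      using insert.hyps by (simp add: D.add D.sum D(3))
    finally have "(\<Sum>c\<in>F. D (x c)) = 0" by simp
    moreover have "D (x e) \<in> E e" if "e \<in> F" for e
      using D(2)[of e] insert.prems that by blast
    ultimately have "D (x c) = 0" using insert.IH[of "\<lambda>c. D (x c)" c] insert.prems c by auto
    thus ?thesis using D(4) insert.prems c by blast
  qed
  moreover from zero have "x d = 0" using insert.prems(3) insert.hyps by simp
  ultimately show ?case using insert.prems(4) by blast
qed simp

text \<open>The map is built through its graph \<open>D\<close>: spanning makes this relation total,
  independence makes it single-valued. Unique existence is what the definite descriptions in
  \<open>semisimplification\<close> and \<open>transfer\<close> require.\<close>

lemma direct_sum_linear_extension:
  fixes E :: "'i \<Rightarrow> 'b set" and L :: "'i \<Rightarrow> 'b \<Rightarrow> 'b"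
  assumes sub: "\<And>c. c \<in> I \<Longrightarrow> subspace (E c)"
    and span: "span (\<Union>c\<in>I. E c) = UNIV"
    and indep: "\<And>F x c. finite F \<Longrightarrow> F \<subseteq> I \<Longrightarrow> (\<And>c. c \<in> F \<Longrightarrow> x c \<in> E c) \<Longrightarrow> (\<Sum>c\<in>F. x c) = 0 \<Longrightarrow>
      c \<in> F \<Longrightarrow> x c = 0"
    and lin: "\<And>c. c \<in> I \<Longrightarrow> Vector_Spaces.linear scale scale (L c)"
  shows "\<exists>!T. Vector_Spaces.linear scale scale T \<and> (\<forall>c\<in>I. \<forall>w\<in>E c. T w = L c w)"
proof -
  define D where "D w y \<longleftrightarrow> (\<exists>F x. finite F \<and> F \<subseteq> I \<and> (\<forall>c\<in>F. x c \<in> E c) \<and>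
    w = (\<Sum>c\<in>F. x c) \<and> y = (\<Sum>c\<in>F. L c (x c)))" for w y
  have L0: "L c 0 = 0" if "c \<in> I" for c
    using lin[OF that] by (rule module_hom.zero[OF module_hom_linearI])
  have D_lin: "D (scale a w + w') (scale a y + y')" if "D w y" "D w' y'" for a w y w' y'
  proof -
    from that(1) obtain F x where F: "finite F" "F \<subseteq> I" "\<forall>c\<in>F. x c \<in> E c"
      "w = (\<Sum>c\<in>F. x c)" "y = (\<Sum>c\<in>F. L c (x c))" unfolding D_def by blast
    from that(2) obtain F' x' where F': "finite F'" "F' \<subseteq> I" "\<forall>c\<in>F'. x' c \<in> E c"
      "w' = (\<Sum>c\<in>F'. x' c)" "y' = (\<Sum>c\<in>F'. L c (x' c))" unfolding D_def by blast
    \<comment> \<open>Extension by zero brings both decompositions to the common index set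
      \<open>F \<union> F'\<close>.\<close>
    define z where "z c = (if c \<in> F then x c else 0)" for c
    define z' where "z' c = (if c \<in> F' then x' c else 0)" for c
    have w: "w = (\<Sum>c\<in>F \<union> F'. z c)"
      unfolding F(4) z_def using F F' by (intro sum.mono_neutral_cong_left) auto
    have w': "w' = (\<Sum>c\<in>F \<union> F'. z' c)"
      unfolding F'(4) z'_def using F F' by (intro sum.mono_neutral_cong_left) auto
    have y: "y = (\<Sum>c\<in>F \<union> F'. L c (z c))"
      unfolding F(5) z_def using F F' L0 by (intro sum.mono_neutral_cong_left) auto
    have y': "y' = (\<Sum>c\<in>F \<union> F'. L c (z' c))"
      unfolding F'(5) z'_def using F F' L0 by (intro sum.mono_neutral_cong_left) auto
    have z: "z c \<in> E c" "z' c \<in> E c" if "c \<in> F \<union> F'" for c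
      using F F' that sub[THEN subspace_0] by (auto simp: z_def z'_def)
    show ?thesis unfolding D_def
    proof (intro exI[of _ "F \<union> F'"] exI[of _ "\<lambda>c. scale a (z c) + z' c"] conjI ballI)
      show "scale a (z c) + z' c \<in> E c" if "c \<in> F \<union> F'" for c
        using z[OF that] sub[of c] F F' that by (blast intro: subspace_add subspace_scale)
      have "L c (scale a (z c) + z' c) = scale a (L c (z c)) + L c (z' c)" if "c \<in> F \<union> F'" for c
        using lin[of c] F F' that by (auto simp: Vector_Spaces.linear_iff)
      thus "scale a y + y' = (\<Sum>c\<in>F \<union> F'. L c (scale a (z c) + z' c))"
        unfolding y y' by (simp add: scale_sum_right sum.distrib)
      show "scale a w + w' = (\<Sum>c\<in>F \<union> F'. scale a (z c) + z' c)"
        unfolding w w' by (simp add: scale_sum_right sum.distrib)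
    qed (use F F' in auto)
  qed
  have D_0: "D 0 0" unfolding D_def by (rule exI[of _ "{}"]) auto
  have D_base: "D w (L c w)" if "c \<in> I" "w \<in> E c" for c w
    unfolding D_def using that by (intro exI[of _ "{c}"] exI[of _ "\<lambda>_. w"]) auto
  have D_inj: "y = 0" if "D 0 y" for y
  proof -
    from that obtain F x where F: "finite F" "F \<subseteq> I" "\<forall>c\<in>F. x c \<in> E c"
      "0 = (\<Sum>c\<in>F. x c)" "y = (\<Sum>c\<in>F. L c (x c))" unfolding D_def by blast
    have "x c = 0" if "c \<in> F" for c using indep[of F x c] F that by auto
    thus ?thesis unfolding F(5) using F(2) L0 by (intro sum.neutral) auto
  qed
  have D_unique: "y = y'" if "D w y" "D w y'" for w y y'
  proof -
    have "D 0 (y' - y)" using D_lin[OF that, of "-1"] by simp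
    from D_inj[OF this] show ?thesis by simp
  qed
  have D_total: "\<exists>y. D w y" for w
  proof -
    have "w \<in> span (\<Union>c\<in>I. E c)" by (simp add: span)
    thus ?thesis
    proof (induction rule: span_induct_alt)
      case base
      show ?case using D_0 by blast
    next
      case (step a x y)
      then obtain c y' where "c \<in> I" "x \<in> E c" "D y y'" by blast
      from D_lin[OF D_base[OF this(1,2)] this(3)] show ?case by blast
    qed
  qed
  interpret self_pair: vector_space_pair scale scale ..
  define T where "T w = (THE y. D w y)" for w
  have T: "D w y \<longleftrightarrow> T w = y" for w y
  proof -
    obtain y0 where y0: "D w y0" using D_total by blast
    hence "T w = y0" unfolding T_def by (rule the_equality) (rule D_unique[OF _ y0])
    thus ?thesis using y0 D_unique by blast
  qed
  have T_lin: "T (scale a w + w') = scale a (T w) + T w'" for a w w'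
    using D_lin[of w "T w" w' "T w'" a] T by blast
  have T0: "T 0 = 0" using D_0 T by blast
  have lT: "Vector_Spaces.linear scale scale T"
    unfolding Vector_Spaces.linear_iff using T_lin[of 1] T_lin[of _ _ 0] T0 vector_space_axioms by simp
  show ?thesis
  proof (rule ex1I[of _ T])
    show "Vector_Spaces.linear scale scale T \<and> (\<forall>c\<in>I. \<forall>w\<in>E c. T w = L c w)"
      using lT D_base T by blast
    fix T' assume T': "Vector_Spaces.linear scale scale T' \<and> (\<forall>c\<in>I. \<forall>w\<in>E c. T' w = L c w)"
    show "T' = T"
    proof
      fix w
      show "T' w = T w"
      proof (rule self_pair.linear_eq_on_span[of T' T "\<Union>c\<in>I. E c"])
        fix x assume "x \<in> (\<Union>c\<in>I. E c)"
        then obtain c where c: "c \<in> I" "x \<in> E c" by blast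
        thus "T' x = T x" using T' D_base[OF c] T by simp
      qed (use T' lT span in auto)
    qed
  qed
qed

section \<open>Generalized eigenspaces of a linear operator\<close>

context
  fixes A assumes A: "Vector_Spaces.linear scale scale A"
begin

interpretation A: Vector_Spaces.linear scale scale A by fact

lemma linear_shift: "Vector_Spaces.linear scale scale (\<lambda>x. A x - scale c x)"
  using A by (auto simp: Vector_Spaces.linear_iff scale_right_distrib scale_right_diff_distrib scale_left_commute)

lemma shift_zero: "((\<lambda>x. A x - scale c x) ^^ k) 0 = 0"
  by (induction k) (simp_all add: A.zero)

lemma shift_commute: "((\<lambda>x. A x - scale c x) ^^ k) (A w - scale d w) =
   A (((\<lambda>x. A x - scale c x) ^^ k) w) - scale d (((\<lambda>x. A x - scale c x) ^^ k) w)"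
proof (induction k)
  case (Suc k)
  have "A (A v - scale d v) - scale c (A v - scale d v) = A (A v - scale c v) - scale d (A v - scale c v)" for v
    by (simp add: A.diff A.scale scale_right_diff_distrib scale_left_commute[of c d] algebra_simps)
  with Suc show ?case by simp
qed simp

lemma subspace_gen_eigenspace: "subspace (gen_eigenspace scale A c)"
proof -
  let ?N = "\<lambda>x. A x - scale c x"
  have lin: "Vector_Spaces.linear scale scale (?N ^^ k)" for k
    by (rule linear_funpow[OF linear_shift])
  \<comment> \<open>Kernels of powers increase, so two exponents can be replaced by their
    sum.\<close>
  have ext: "(?N ^^ (j + k)) w = 0" if "(?N ^^ k) w = 0" for j k w
    using that by (simp add: funpow_add shift_zero)
  show ?thesis
    unfolding subspace_def gen_eigenspace_def
  proof (intro conjI ballI allI; clarsimp)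
    show "\<exists>k. (?N ^^ k) 0 = 0" using shift_zero by blast
    show "\<exists>k. (?N ^^ k) (x + y) = 0" if "(?N ^^ k) x = 0" "(?N ^^ k') y = 0" for x y k k'
      using ext[OF that(1), of k'] ext[OF that(2), of k] lin[of "k + k'"]
      by (intro exI[of _ "k + k'"]) (simp add: Vector_Spaces.linear_iff add.commute)
    show "\<exists>k. (?N ^^ k) (scale a x) = 0" if "(?N ^^ k) x = 0" for x k a
      using that lin[of k] by (intro exI[of _ k]) (simp add: Vector_Spaces.linear_iff)
  qed
qed

lemma shift_in_gen_eigenspace:
  assumes "w \<in> gen_eigenspace scale A c"
  shows "A w - scale d w \<in> gen_eigenspace scale A c"
proof -
  obtain k where "((\<lambda>x. A x - scale c x) ^^ k) w = 0" using assms by (auto simp: gen_eigenspace_def)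
  hence "((\<lambda>x. A x - scale c x) ^^ k) (A w - scale d w) = 0"
    unfolding shift_commute by (simp add: A.zero)
  thus ?thesis by (auto simp: gen_eigenspace_def)
qed

text \<open>On this space the shift by \<open>d\<close> is \<open>c - d\<close> plus a locally
  nilpotent operator \<open>?N\<close>. Induction on the exponent annihilating \<open>w\<close>: if
  \<open>z\<close> is a preimage of \<open>?N w\<close>, then \<open>(w - z) / (c - d)\<close> is
  one of \<open>w\<close>.\<close>

lemma shift_surj_on_gen_eigenspace:
  assumes "w \<in> gen_eigenspace scale A c" "c \<noteq> d"
  shows "\<exists>z\<in>gen_eigenspace scale A c. A z - scale d z = w"
proof -
  let ?N = "\<lambda>x. A x - scale c x"
  obtain k where "(?N ^^ k) w = 0" using assms by (auto simp: gen_eigenspace_def)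
  thus ?thesis
  proof (induction k arbitrary: w)
    case 0
    thus ?case using subspace_0[OF subspace_gen_eigenspace] by (intro bexI[of _ 0]) (auto simp: A.zero)
  next
    case (Suc k)
    define e where "e = 1 / (c - d)"
    have e: "e * c - e * d = 1" using assms(2) by (simp add: e_def flip: diff_divide_distrib)
    have "(?N ^^ k) (?N w) = 0" using Suc.prems by (simp only: funpow_Suc_right o_apply)
    from Suc.IH[OF this] obtain z where z: "z \<in> gen_eigenspace scale A c" "A z - scale d z = ?N w" by blast
    have w: "w \<in> gen_eigenspace scale A c" using Suc.prems unfolding gen_eigenspace_def by blast
    show ?case
    proof (rule bexI[of _ "scale e (w - z)"])
      have "A (scale e (w - z)) - scale d (scale e (w - z)) = scale e ((A w - scale d w) - (A z - scale d z))"
        by (simp add: A.scale A.diff scale_right_diff_distrib scale_left_commute[of d e] algebra_simps)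
      also have "(A w - scale d w) - (A z - scale d z) = scale (c - d) w"
        unfolding z(2) by (simp add: scale_left_diff_distrib)
      also have "scale e (scale (c - d) w) = w"
        using e by (simp add: right_diff_distrib)
      finally show "A (scale e (w - z)) - scale d (scale e (w - z)) = w" .
      show "scale e (w - z) \<in> gen_eigenspace scale A c"
        using z(1) w subspace_gen_eigenspace by (blast intro: subspace_scale subspace_diff)
    qed
  qed
qed

text \<open>On a \<open>d\<close>-eigenvector the shift by \<open>c\<close> acts as the nonzero
  scalar \<open>d - c\<close>, so no power of it can kill a nonzero vector.\<close>

lemma eigenvector_in_gen_eigenspace:
  assumes "w \<in> gen_eigenspace scale A c" "A w - scale d w = 0" "c \<noteq> d"
  shows "w = 0"
proof -
  let ?N = "\<lambda>x. A x - scale c x"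
  obtain k where "(?N ^^ k) w = 0" using assms by (auto simp: gen_eigenspace_def)
  thus ?thesis
  proof (induction k)
    case (Suc k)
    have "?N w = scale (d - c) w" using assms(2) by (simp add: scale_left_diff_distrib)
    moreover have "(?N ^^ Suc k) w = (?N ^^ k) (?N w)" by (simp only: funpow_Suc_right o_apply)
    ultimately have "scale (d - c) ((?N ^^ k) w) = 0"
      using Suc.prems linear_funpow[OF linear_shift, of k c] by (simp add: Vector_Spaces.linear_iff)
    thus ?case using Suc.IH assms(3) by simp
  qed simp
qed

text \<open>The separating operator is the power of the shift by \<open>d\<close> that kills
  \<open>x\<close>; it preserves all generalized eigenspaces and is injective on that of
  \<open>c\<close>.\<close>

lemma gen_eigenspaces_direct_sum:
  assumes "finite F" "\<And>c. c \<in> F \<Longrightarrow> x c \<in> gen_eigenspace scale A c" "(\<Sum>c\<in>F. x c) = 0" "c \<in> F"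
  shows "x c = 0"
proof (rule direct_sum_if_separated[where I = UNIV and E = "gen_eigenspace scale A"])
  fix c d x assume "c \<noteq> d" "x \<in> gen_eigenspace scale A d"
  then obtain k where k: "((\<lambda>x. A x - scale d x) ^^ k) x = 0" by (auto simp: gen_eigenspace_def)
  let ?D = "(\<lambda>x. A x - scale d x) ^^ k"
  have pres: "(((\<lambda>x. A x - scale d x) ^^ k) y) \<in> gen_eigenspace scale A e" if "y \<in> gen_eigenspace scale A e" for e k y
    by (induction k) (use that shift_in_gen_eigenspace in auto)
  have "y = 0" if "((\<lambda>x. A x - scale d x) ^^ k) y = 0" "y \<in> gen_eigenspace scale A c" for k y
    using that
  proof (induction k)
    case (Suc k)
    thus ?case using eigenvector_in_gen_eigenspace[OF pres[OF Suc.prems(2)] _ \<open>c \<noteq> d\<close>] by simp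
  qed simp
  thus "\<exists>D. Vector_Spaces.linear scale scale D \<and> (\<forall>e\<in>UNIV. D ` gen_eigenspace scale A e \<subseteq> gen_eigenspace scale A e) \<and>
      D x = 0 \<and> (\<forall>y\<in>gen_eigenspace scale A c. D y = 0 \<longrightarrow> y = 0)"
    using k pres by (intro exI[of _ ?D] conjI linear_funpow linear_shift) auto
qed (use assms in auto)

text \<open>Surjectivity on the eigenspaces of \<open>c \<noteq> d\<close> writes the shifted
  \<open>w\<close> as a shifted \<open>z\<close> plus some \<open>y\<close> in the eigenspace of
  \<open>d\<close>. The shift maps \<open>w - z\<close> to \<open>y\<close>, so \<open>w - z\<close>
  is a generalized eigenvector for \<open>d\<close> as well.\<close>

lemma shift_reflects_span_gen_eigenspaces:
  assumes "A w - scale d w \<in> span (\<Union>c. gen_eigenspace scale A c)"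
  shows "w \<in> span (\<Union>c. gen_eigenspace scale A c)"
proof -
  let ?G = "span (\<Union>c. gen_eigenspace scale A c)"
  have "\<exists>z\<in>?G. \<exists>y\<in>gen_eigenspace scale A d. v = (A z - scale d z) + y" if "v \<in> ?G" for v
    using that
  proof (induction rule: span_induct_alt)
    case base
    show ?case using span_zero subspace_0[OF subspace_gen_eigenspace]
      by (intro bexI[of _ 0]) (auto simp: A.zero)
  next
    case (step a x v)
    then obtain z y where zy: "z \<in> ?G" "y \<in> gen_eigenspace scale A d" "v = (A z - scale d z) + y" by blast
    obtain c where c: "x \<in> gen_eigenspace scale A c" using step by blast
    show ?case
    proof (cases "c = d")
      case True
      have "scale a x + y \<in> gen_eigenspace scale A d"
        using c zy(2) True subspace_gen_eigenspace by (blast intro: subspace_add subspace_scale)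
      moreover have "scale a x + v = (A z - scale d z) + (scale a x + y)" by (simp add: zy(3) algebra_simps)
      ultimately show ?thesis using zy(1) by blast
    next
      case False
      obtain z' where z': "z' \<in> gen_eigenspace scale A c" "A z' - scale d z' = x"
        using shift_surj_on_gen_eigenspace[OF c False] by blast
      have "scale a z' + z \<in> ?G" using z'(1) zy(1) by (blast intro: span_add span_scale span_base)
      moreover have "scale a x + v = (A (scale a z' + z) - scale d (scale a z' + z)) + y"
        unfolding zy(3) z'(2)[symmetric]
        by (simp add: A.add A.scale scale_right_distrib scale_right_diff_distrib scale_left_commute[of a d] algebra_simps)
      ultimately show ?thesis using zy(2) by blast
    qed
  qed
  then obtain z y where zy: "z \<in> ?G" "y \<in> gen_eigenspace scale A d" "A w - scale d w = (A z - scale d z) + y"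
    using assms by blast
  from zy(2) obtain k where k: "((\<lambda>x. A x - scale d x) ^^ k) y = 0" by (auto simp: gen_eigenspace_def)
  have "A (w - z) - scale d (w - z) = y"
    using zy(3) by (simp add: A.diff scale_right_diff_distrib algebra_simps)
  hence "((\<lambda>x. A x - scale d x) ^^ Suc k) (w - z) = 0"
    unfolding funpow_Suc_right o_apply using k by simp
  hence "w - z \<in> gen_eigenspace scale A d" unfolding gen_eigenspace_def by blast
  hence "(w - z) + z \<in> ?G" using zy(1) by (blast intro: span_add span_base)
  thus ?thesis by simp
qed

end

end

section \<open>Spectral decomposition over the complex numbers\<close>

context
  fixes s :: "complex \<Rightarrow> 'b::ab_group_add \<Rightarrow> 'b" and A :: "'b \<Rightarrow> 'b"
  assumes vs: "vector_space s" and A: "Vector_Spaces.linear s s A"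
begin

interpretation vector_space s by (fact vs)
interpretation A: Vector_Spaces.linear s s A by (fact A)

text \<open>A root \<open>d\<close> of \<open>p\<close> splits off a linear factor; the cofactor
  annihilates the shift of \<open>w\<close> by \<open>d\<close>, and
  \<open>shift_reflects_span_gen_eigenspaces\<close> passes back to \<open>w\<close>.\<close>

lemma annihilated_in_span_gen_eigenspaces:
  assumes "p \<noteq> 0" "degree p \<le> N" "(\<Sum>i\<le>N. s (coeff p i) ((A ^^ i) w)) = 0"
  shows "w \<in> module.span s (\<Union>c. gen_eigenspace s A c)"
  using assms
proof (induction N arbitrary: p w)
  case 0
  then obtain c where "p = [:c:]" "c \<noteq> 0" by (auto elim: degree_eq_zeroE)
  with 0 have "w = 0" by simp
  thus ?case by (simp add: span_zero)
next
  case (Suc N)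
  show ?case
  proof (cases "degree p = 0")
    case True
    with Suc.prems obtain c where p: "p = [:c:]" "c \<noteq> 0" by (auto elim: degree_eq_zeroE)
    have "(\<Sum>i\<le>Suc N. s (coeff p i) ((A ^^ i) w)) = (\<Sum>i\<le>Suc N. if i = 0 then s c w else 0)"
      by (intro sum.cong) (auto simp: p coeff_pCons split: nat.splits)
    hence "w = 0" using Suc.prems(3) p(2) by simp
    thus ?thesis by (simp add: span_zero)
  next
    case False
    then obtain d where "poly p d = 0"
      using fundamental_theorem_of_algebra[of p] by (auto simp: constant_degree)
    then obtain r where r: "p = [:- d, 1:] * r" by (auto simp: poly_eq_0_iff_dvd)
    have r0: "r \<noteq> 0" using Suc.prems(1) r by auto
    have "degree p = Suc (degree r)" unfolding r using r0 by (subst degree_mult_eq) auto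
    hence deg: "degree r \<le> N" using Suc.prems(2) by simp
    \<comment> \<open>The vanishing top coefficient lets the sum for \<open>d * r\<close> stop at
      \<open>N\<close>, matching the index shift of \<open>pCons 0 r\<close>.\<close>
    hence rN: "coeff r (Suc N) = 0" by (simp add: coeff_eq_0)
    have lin: "Vector_Spaces.linear s s (A ^^ i)" for i by (rule linear_funpow[OF A])
    have "0 = (\<Sum>i\<le>Suc N. s (coeff p i) ((A ^^ i) w))" using Suc.prems(3) by simp
    also have "\<dots> = (\<Sum>i\<le>Suc N. s (coeff (pCons 0 r) i) ((A ^^ i) w)) -
        (\<Sum>i\<le>Suc N. s (d * coeff r i) ((A ^^ i) w))"
      unfolding sum_subtractf[symmetric]
      by (intro sum.cong refl) (simp add: r scale_left_diff_distrib[symmetric])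
    also have "(\<Sum>i\<le>Suc N. s (d * coeff r i) ((A ^^ i) w)) = (\<Sum>i\<le>N. s (d * coeff r i) ((A ^^ i) w))"
      by (simp add: rN)
    also have "(\<Sum>i\<le>Suc N. s (coeff (pCons 0 r) i) ((A ^^ i) w)) = (\<Sum>i\<le>N. s (coeff r i) ((A ^^ Suc i) w))"
      by (subst sum.atMost_Suc_shift) simp
    also have "\<dots> - (\<Sum>i\<le>N. s (d * coeff r i) ((A ^^ i) w)) = (\<Sum>i\<le>N. s (coeff r i) ((A ^^ i) (A w - s d w)))"
      unfolding sum_subtractf[symmetric]
    proof (intro sum.cong refl)
      fix i
      interpret Ai: Vector_Spaces.linear s s "A ^^ i" by (rule lin)
      show "s (coeff r i) ((A ^^ Suc i) w) - s (d * coeff r i) ((A ^^ i) w) = s (coeff r i) ((A ^^ i) (A w - s d w))"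
        by (simp add: Ai.diff Ai.scale scale_right_diff_distrib funpow_swap1 mult.commute)
    qed
    finally have "A w - s d w \<in> span (\<Union>c. gen_eigenspace s A c)"
      by (intro Suc.IH[OF r0 deg]) simp
    thus ?thesis by (rule shift_reflects_span_gen_eigenspaces[OF A])
  qed
qed

text \<open>The \<open>n + 1\<close> iterates of \<open>w\<close>, with \<open>n\<close> the size of
  a spanning set, satisfy a linear relation, that is, a nonzero polynomial in \<open>A\<close>
  annihilates \<open>w\<close>.\<close>

lemma span_gen_eigenspaces:
  assumes "finite_dim s UNIV"
  shows "module.span s (\<Union>c. gen_eigenspace s A c) = UNIV"
proof -
  obtain B where B: "finite B" "span B = UNIV" using assms by (auto simp: finite_dim_def)
  have "w \<in> span (\<Union>c. gen_eigenspace s A c)" for w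
  proof -
    define n where "n = card B"
    have "\<exists>p. p \<noteq> 0 \<and> degree p \<le> n \<and> (\<Sum>i\<le>n. s (coeff p i) ((A ^^ i) w)) = 0"
    proof (cases "inj_on (\<lambda>i. (A ^^ i) w) {..n}")
      case True
      define S where "S = (\<lambda>i. (A ^^ i) w) ` {..n}"
      have "card S = Suc n" unfolding S_def using True by (simp add: card_image)
      hence "dependent S" using independent_span_bound[OF B(1), of S] B(2) by (auto simp: n_def)
      then obtain a where a: "\<exists>v\<in>S. a v \<noteq> 0" "(\<Sum>v\<in>S. s (a v) v) = 0"
        using dependent_finite[of S] by (auto simp: S_def)
      define p where "p = (\<Sum>i\<le>n. monom (a ((A ^^ i) w)) i)"
      have c: "coeff p i = (if i \<le> n then a ((A ^^ i) w) else 0)" for i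
        by (simp add: p_def coeff_sum)
      have "p \<noteq> 0" using a(1) c unfolding S_def by (auto simp: poly_eq_iff)
      moreover have "degree p \<le> n" using c by (intro degree_le) auto
      moreover have "(\<Sum>i\<le>n. s (coeff p i) ((A ^^ i) w)) = (\<Sum>v\<in>S. s (a v) v)"
        unfolding S_def sum.reindex[OF True] by (intro sum.cong) (auto simp: c)
      ultimately show ?thesis using a(2) by auto
    next
      case False
      then obtain i j where ij: "i \<le> n" "j \<le> n" "i \<noteq> j" "(A ^^ i) w = (A ^^ j) w" by (auto simp: inj_on_def)
      \<comment> \<open>Dependence speaks of sets of vectors, so a repeated iterate is treated
        apart: it gives the relation \<open>X^i - X^j\<close>.\<close>
      define p where "p = monom 1 i - monom (1::complex) j"
      have "coeff p i \<noteq> 0" using ij by (simp add: p_def)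
      hence "p \<noteq> 0" by auto
      moreover have "degree p \<le> n" unfolding p_def using ij
        by (intro degree_le) auto
      moreover have "(\<Sum>k\<le>n. s (coeff p k) ((A ^^ k) w)) =
        (\<Sum>k\<le>n. if k = i then (A ^^ i) w else 0) - (\<Sum>k\<le>n. if k = j then (A ^^ j) w else 0)"
        unfolding sum_subtractf[symmetric] using ij by (intro sum.cong) (auto simp: p_def)
      hence "(\<Sum>k\<le>n. s (coeff p k) ((A ^^ k) w)) = 0" using ij by simp
      ultimately show ?thesis by blast
    qed
    thus ?thesis using annihilated_in_span_gen_eigenspaces by blast
  qed
  thus ?thesis by blast
qed

text \<open>The description in \<open>semisimplification\<close> denotes: it prescribes scaling by
  \<open>c\<close> on each summand of the generalized eigenspace decomposition.\<close>

lemma linear_semisimplification: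
  assumes "finite_dim s UNIV"
  shows "Vector_Spaces.linear s s (semisimplification s A)"
proof -
  have "\<exists>!S. Vector_Spaces.linear s s S \<and> (\<forall>c\<in>UNIV. \<forall>w\<in>gen_eigenspace s A c. S w = s c w)"
    using subspace_gen_eigenspace[OF A] span_gen_eigenspaces[OF assms] gen_eigenspaces_direct_sum[OF A] linear_scale_self
    by (intro direct_sum_linear_extension) auto
  hence "\<exists>!S. Vector_Spaces.linear s s S \<and>
      (\<forall>c w. (\<exists>k. ((\<lambda>x. A x - s c x) ^^ k) w = 0) \<longrightarrow> S w = s c w)"
    by (simp add: gen_eigenspace_def)
  from theI'[OF this] show ?thesis by (simp add: semisimplification_def)
qed

end

section \<open>Linearity of the transfer-matrices\<close>

lemma power_int_inj:
  fixes q :: complex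
  assumes q: "q \<noteq> 0" "\<And>n. n > 0 \<Longrightarrow> q ^ n \<noteq> 1" and eq: "q powi a = q powi b"
  shows "a = b"
proof -
  have *: False if "a < b" "q powi a = q powi b" for a b
  proof -
    have "q powi (b - a) = 1" using that(2) q(1) by (simp add: power_int_diff)
    hence "q ^ nat (b - a) = 1" using that(1) by (simp add: power_int_def)
    thus False using q(2) that(1) by simp
  qed
  show ?thesis using *[of a b] *[of b a] eq by (cases a b rule: linorder_cases) auto
qed

lemma weight_space_cong:
  assumes "\<And>i. i \<in> verts X \<Longrightarrow> \<omega> i = \<omega>' i"
  shows "weight_space X V \<omega> = weight_space X V \<omega>'"
  using assms by (simp add: weight_space_def)

text \<open>Serves \<open>eop\<close> and \<open>fop\<close> with \<open>\<alpha>\<close> a column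
  of the affine Cartan matrix up to sign, and \<open>kop\<close> and its inverse with
  \<open>\<alpha>\<close> zero.\<close>

lemma weight_space_shift:
  assumes "q \<noteq> 0" "vector_space (scl V)" "Vector_Spaces.linear (scl V) (scl V) A"
    and "\<And>i v. i \<in> verts X \<Longrightarrow> kop V i (A v) = scl V (q powi \<alpha> i) (A (kop V i v))"
    and "w \<in> weight_space X V (P_weight q \<mu>)"
  shows "A w \<in> weight_space X V (P_weight q (\<lambda>i. \<alpha> i + \<mu> i))"
proof -
  interpret vector_space "scl V" by fact
  show ?thesis
    using assms(1,3-) by (auto simp: weight_space_def P_weight_def power_int_add Vector_Spaces.linear_iff)
qed

section \<open>Weight decomposition of the module\<close>

locale drinfeld_module =
  fixes X :: folding and q :: complex and W :: "('w::ab_group_add, 'y) affine_module_scheme"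
    and P :: "nat \<Rightarrow> complex poly"
  assumes q0: "q \<noteq> 0" and q_root: "\<And>n. n > 0 \<Longrightarrow> q ^ n \<noteq> 1"
    and simple: "simple_affine_module X q W"
    and drinfeld: "has_drinfeld_polynomials X q W P"
begin

lemma affine: "is_affine_module X q W"
  using simple by (simp only: simple_affine_module_def)

lemma borel: "is_borel_module X q W"
  using affine by (simp only: is_affine_module_def)

sublocale vector_space "scl W"
  using borel by (simp only: is_borel_module_def)

lemma verts_le: "i \<in> verts X \<Longrightarrow> i \<le> rk X" by (simp add: verts_def)

lemma
  assumes "i \<le> rk X"
  shows linear_eop: "Vector_Spaces.linear (scl W) (scl W) (eop W i)"
    and linear_kop: "Vector_Spaces.linear (scl W) (scl W) (kop W i)"
    and bij_kop: "bij (kop W i)"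
    and linear_fop: "Vector_Spaces.linear (scl W) (scl W) (fop W i)"
  using borel[unfolded is_borel_module_def, THEN conjunct2, THEN conjunct1] assms
    affine[unfolded is_affine_module_def, THEN conjunct2, THEN conjunct1] by blast+

lemma
  assumes "i \<le> rk X" "j \<le> rk X"
  shows kop_commute: "kop W i (kop W j v) = kop W j (kop W i v)"
    and kop_eop: "kop W i (eop W j v) = scl W (q powi acartan X i j) (eop W j (kop W i v))"
    and kop_fop: "kop W i (fop W j v) = scl W (q powi (- acartan X i j)) (fop W j (kop W i v))"
  using borel[unfolded is_borel_module_def, THEN conjunct2, THEN conjunct2, THEN conjunct1, rule_format, OF assms]
    affine[unfolded is_affine_module_def, THEN conjunct2, THEN conjunct2, THEN conjunct1, rule_format, OF assms]
  by simp_all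

lemma linear_inv_kop:
  assumes "i \<le> rk X"
  shows "Vector_Spaces.linear (scl W) (scl W) (inv (kop W i))"
  by (rule linear_module_homI[OF bij_module_hom_imp_inv_module_hom[OF module_hom_linearI[OF linear_kop] bij_kop]])
    (rule assms)+

lemma kop_inv_kop:
  assumes "i \<le> rk X" "j \<le> rk X"
  shows "kop W i (inv (kop W j) v) = inv (kop W j) (kop W i v)"
proof -
  have "kop W j (kop W i (inv (kop W j) v)) = kop W i v"
    using kop_commute[OF assms(2,1)] bij_kop[OF assms(2)] by (simp add: bij_is_surj surj_f_inv_f)
  thus ?thesis using bij_kop[OF assms(2)] by (metis bij_inv_eq_iff)
qed

abbreviation ws :: "(nat \<Rightarrow> int) \<Rightarrow> 'w set" where
  "ws \<mu> \<equiv> weight_space X W (P_weight q \<mu>)"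

text \<open>Only the values on \<open>verts X\<close> matter, so a weight space has infinitely many
  labels; the value 0 elsewhere selects one, as a direct sum over labels requires.\<close>

definition supported_weights :: "(nat \<Rightarrow> int) set" where
  "supported_weights = {\<mu>. \<forall>i. i \<notin> verts X \<longrightarrow> \<mu> i = 0}"

definition restrict_weight :: "(nat \<Rightarrow> int) \<Rightarrow> nat \<Rightarrow> int" where
  "restrict_weight \<mu> i = (if i \<in> verts X then \<mu> i else 0)"

lemma restrict_weight_in_supported_weights: "restrict_weight \<mu> \<in> supported_weights"
  by (simp add: restrict_weight_def supported_weights_def)

lemma ws_restrict_weight: "ws (restrict_weight \<mu>) = ws \<mu>"
  by (rule weight_space_cong) (simp add: restrict_weight_def P_weight_def)

lemma subspace_ws: "subspace (ws \<mu>)"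
proof -
  have add: "kop W i (x + y) = kop W i x + kop W i y"
    and scale: "kop W i (scl W c x) = scl W c (kop W i x)" if "i \<in> verts X" for i x y c
    using linear_kop[OF verts_le[OF that]] by (auto simp: Vector_Spaces.linear_iff)
  have "kop W i 0 = 0" if "i \<in> verts X" for i using scale[OF that, of 0 0] by simp
  thus ?thesis unfolding subspace_def weight_space_def
    by (simp add: add scale scale_right_distrib mult.commute)
qed

lemma UN_ws_supported_weights: "(\<Union>\<mu>\<in>supported_weights. ws \<mu>) = (\<Union>\<mu>. ws \<mu>)"
proof
  show "(\<Union>\<mu>. ws \<mu>) \<subseteq> (\<Union>\<mu>\<in>supported_weights. ws \<mu>)"
  proof
    fix w assume "w \<in> (\<Union>\<mu>. ws \<mu>)"
    then obtain \<mu> where "w \<in> ws (restrict_weight \<mu>)" unfolding ws_restrict_weight by blast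
    thus "w \<in> (\<Union>\<mu>\<in>supported_weights. ws \<mu>)" using restrict_weight_in_supported_weights by blast
  qed
qed blast

text \<open>All generators shift integral weights, so the span is a submodule. It contains the
  highest \<open>l\<close>-weight vector, and simplicity makes it the whole space.\<close>

lemma span_ws: "span (\<Union>\<mu>\<in>supported_weights. ws \<mu>) = UNIV"
proof -
  let ?S = "span (\<Union>\<mu>. ws \<mu>)"
  have inv: "A ` ?S \<subseteq> ?S" if A: "Vector_Spaces.linear (scl W) (scl W) A"
    and "\<And>\<mu> w. w \<in> ws \<mu> \<Longrightarrow> \<exists>\<mu>'. A w \<in> ws \<mu>'" for A
  proof -
    interpret A: Vector_Spaces.linear "scl W" "scl W" A by fact
    have "(\<Union>\<mu>. ws \<mu>) \<subseteq> A -` ?S" using that(2) by (blast intro: span_base)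
    hence "?S \<subseteq> A -` ?S" by (rule span_minimal) (rule A.subspace_vimage[OF subspace_span])
    thus ?thesis by blast
  qed
  note shift = weight_space_shift[OF q0 vector_space_axioms]
  have "borel_invariant X W ?S"
    unfolding borel_invariant_def
  proof (intro conjI allI impI subspace_span)
    fix i assume i: "i \<le> rk X"
    show "eop W i ` ?S \<subseteq> ?S"
      using shift[OF linear_eop[OF i] kop_eop[OF verts_le i]] by (intro inv linear_eop i) blast
    show "kop W i ` ?S \<subseteq> ?S"
      using shift[OF linear_kop[OF i], where \<alpha> = "\<lambda>_. 0"] kop_commute[OF verts_le i]
      by (intro inv linear_kop i) (simp, blast)
    show "inv (kop W i) ` ?S \<subseteq> ?S"
      using shift[OF linear_inv_kop[OF i], where \<alpha> = "\<lambda>_. 0"] kop_inv_kop[OF verts_le i]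
      by (intro inv linear_inv_kop i) (simp, blast)
  qed
  moreover have "fop W i ` ?S \<subseteq> ?S" if i: "i \<le> rk X" for i
    using shift[OF linear_fop[OF i] kop_fop[OF verts_le i]] by (intro inv linear_fop i) blast
  ultimately have "?S = {0} \<or> ?S = UNIV"
    using simple unfolding simple_affine_module_def by blast
  moreover have "?S \<noteq> {0}"
  proof -
    obtain v where v: "has_l_weight X q W (drinfeld_l_weight q P) v"
      and P: "\<And>i. i \<in> verts X \<Longrightarrow> coeff (P i) 0 = 1"
      using drinfeld unfolding has_drinfeld_polynomials_def by blast
    have "kop W i v = scl W (P_weight q (\<lambda>i. int (degree (P i))) i) v" if "i \<in> verts X" for i
    proof -
      have "phi X q W i 0 v = scl W (fps_nth (drinfeld_l_weight q P i) 0) v"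
        using v that unfolding has_l_weight_def by blast
      \<comment> \<open>At \<open>z = 0\<close> both polynomial factors equal 1, leaving
        \<open>q ^ degree (P i)\<close>: the highest weight is integral.\<close>
      moreover have "fps_nth (drinfeld_l_weight q P i) 0 = P_weight q (\<lambda>i. int (degree (P i))) i"
        using P[OF that] by (simp add: drinfeld_l_weight_def P_weight_def poly_0_coeff_0)
      ultimately show ?thesis by simp
    qed
    hence "v \<in> ws (\<lambda>i. int (degree (P i)))" by (simp add: weight_space_def)
    hence "v \<in> ?S" by (blast intro: span_base)
    moreover have "v \<noteq> 0" using v by (simp add: has_l_weight_def)
    ultimately show ?thesis by blast
  qed
  ultimately show ?thesis unfolding UN_ws_supported_weights by blast
qed

text \<open>Distinct labels differ at some vertex \<open>i\<close>; subtracting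
  \<open>q powi d i\<close> from \<open>kop W i\<close> kills \<open>ws d\<close> and acts by a
  nonzero scalar on \<open>ws c\<close>.\<close>

lemma ws_direct_sum:
  assumes "finite F" "F \<subseteq> supported_weights" "\<And>c. c \<in> F \<Longrightarrow> x c \<in> ws c" "(\<Sum>c\<in>F. x c) = 0" "c \<in> F"
  shows "x c = 0"
proof (rule direct_sum_if_separated[where I = supported_weights and E = ws])
  fix c d x assume cd: "c \<in> supported_weights" "d \<in> supported_weights" "c \<noteq> d" and x: "x \<in> ws d"
  then obtain i where i: "i \<in> verts X" "c i \<noteq> d i" by (auto simp: supported_weights_def fun_eq_iff) metis
  let ?D = "\<lambda>x. kop W i x - scl W (q powi d i) x"
  have D: "Vector_Spaces.linear (scl W) (scl W) ?D"
    by (intro linear_shift linear_kop verts_le i)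
  have "?D y \<in> ws e" if "y \<in> ws e" for e y
  proof -
    have "kop W i y = scl W (q powi e i) y" using that i(1) by (simp add: weight_space_def P_weight_def)
    thus ?thesis using that subspace_ws by (simp add: subspace_diff subspace_scale)
  qed
  moreover have "y = 0" if "y \<in> ws c" "?D y = 0" for y
  proof -
    have "kop W i y = scl W (q powi c i) y" using that i(1) by (simp add: weight_space_def P_weight_def)
    hence "scl W (q powi c i - q powi d i) y = 0" using that(2) by (simp add: scale_left_diff_distrib)
    moreover have "q powi c i \<noteq> q powi d i" using power_int_inj[OF q0 q_root] i(2) by blast
    ultimately show ?thesis by simp
  qed
  moreover have "?D x = 0" using x i(1) by (simp add: weight_space_def P_weight_def)
  ultimately show "\<exists>D. Vector_Spaces.linear (scl W) (scl W) D \<and> (\<forall>e\<in>supported_weights. D ` ws e \<subseteq> ws e) \<and> D x = 0 \<and>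
      (\<forall>y\<in>ws c. D y = 0 \<longrightarrow> y = 0)"
    using D by (intro exI[of _ ?D]) blast
qed (use assms in auto)

section \<open>Linearity of transfer-matrices and agreement along orbits\<close>

lemma linear_word_op_fop:
  assumes "set b \<subseteq> {0..rk X}"
  shows "Vector_Spaces.linear (scl W) (scl W) (word_op (fop W) b)"
  using assms
proof (induction b)
  case (Cons i b)
  have "Vector_Spaces.linear (scl W) (scl W) (fop W i)" by (rule linear_fop) (use Cons.prems in simp)
  with Cons show ?case by (simp add: word_op_def Vector_Spaces.linear_iff)
qed (simp add: word_op_def linear_id)

text \<open>The prescription \<open>L\<close> sees a weight only through its values on
  \<open>verts X\<close>, so prescribing it for all labels is consistent and amounts to prescribing
  it on the direct sum over \<open>supported_weights\<close>.\<close>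

lemma linear_transfer: "Vector_Spaces.linear (scl W) (scl W) (transfer X q V u W n)"
proof -
  define L where "L \<mu> w = (\<Sum>b\<in>delta_words X n. \<Sum>b'\<in>delta_words X n.
           scl W (theta_coeff X q n b b' * twisted_trace X q V u \<mu> b) (word_op (fop W) b' w))" for \<mu> w
  have "Vector_Spaces.linear (scl W) (scl W) (L \<mu>)" for \<mu>
  proof -
    have "Vector_Spaces.linear (scl W) (scl W) (word_op (fop W) b')" if "b' \<in> delta_words X n" for b'
      using that by (intro linear_word_op_fop) (simp add: delta_words_def)
    hence "word_op (fop W) b' (x + y) = word_op (fop W) b' x + word_op (fop W) b' y"
      "word_op (fop W) b' (scl W c x) = scl W c (word_op (fop W) b' x)" if "b' \<in> delta_words X n" for b' x y c
      using that by (auto simp: Vector_Spaces.linear_iff)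
    thus ?thesis unfolding Vector_Spaces.linear_iff L_def using vector_space_axioms
      by (simp add: scale_right_distrib sum.distrib scale_sum_right mult.commute cong: sum.cong)
  qed
  hence ex1: "\<exists>!T. Vector_Spaces.linear (scl W) (scl W) T \<and> (\<forall>\<mu>\<in>supported_weights. \<forall>w\<in>ws \<mu>. T w = L \<mu> w)"
    by (intro direct_sum_linear_extension subspace_ws span_ws ws_direct_sum)
  have "L (restrict_weight \<mu>) = L \<mu>" for \<mu>
  proof -
    have "(\<Sum>i\<in>verts X. int (\<gamma> i) * restrict_weight \<mu> i) = (\<Sum>i\<in>verts X. int (\<gamma> i) * \<mu> i)" for \<gamma>
      by (intro sum.cong) (auto simp: restrict_weight_def)
    hence "twisted_trace X q V u (restrict_weight \<mu>) = twisted_trace X q V u \<mu>"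
      by (simp add: twisted_trace_def fun_eq_iff)
    thus ?thesis by (simp add: L_def fun_eq_iff)
  qed
  hence "(\<forall>\<mu>\<in>supported_weights. \<forall>w\<in>ws \<mu>. T w = L \<mu> w) \<longleftrightarrow> (\<forall>\<mu>. \<forall>w\<in>ws \<mu>. T w = L \<mu> w)" for T
    using restrict_weight_in_supported_weights ws_restrict_weight by metis
  with ex1 have "\<exists>!T. Vector_Spaces.linear (scl W) (scl W) T \<and> (\<forall>\<mu>. \<forall>w\<in>ws \<mu>. T w = L \<mu> w)" by simp
  from theI'[OF this] show ?thesis by (simp add: transfer_def L_def)
qed

lemma transfer_ss_eq_on_invariant_subspace:
  assumes "finite_dim (scl W) UNIV" "v \<in> invariant_subspace X q Rp Rm u W" "j \<in> verts X"
  shows "transfer_ss X q (Rp j) u W n v = transfer_ss X q (Rp (sigma X j)) u W n v"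
proof -
  interpret self_pair: vector_space_pair "scl W" "scl W" ..
  have lin: "Vector_Spaces.linear (scl W) (scl W) (transfer_ss X q V u W n)" for V :: "('a, 'b) borel_module_scheme"
    unfolding transfer_ss_def by (intro linear_semisimplification vector_space_axioms linear_transfer assms(1))
  show ?thesis
    by (rule self_pair.linear_eq_on_span[OF lin lin _ assms(2)[unfolded invariant_subspace_def]])
       (use assms(3) in \<open>auto simp: invariant_weight_part_def\<close>)
qed

end

section \<open>Equality of Baxter polynomials on orbits and the folded equations\<close>

theorem theorem5p11:
  fixes X :: folding and q :: complex
    and W :: "'w::ab_group_add affine_module"
    and Rp Rm :: "nat \<Rightarrow> 'v::ab_group_add borel_module"
    and P B :: "nat \<Rightarrow> complex poly"
    and u \<kappa> :: "nat \<Rightarrow> complex"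
    and f \<Lambda> :: "nat \<Rightarrow> complex fps"
    and v :: 'w
    and m :: "nat \<Rightarrow> nat" and w :: "nat \<Rightarrow> nat \<Rightarrow> complex"
  assumes "valid_folding X"
    and "q \<noteq> 0" and "\<And>n. n > 0 \<Longrightarrow> q ^ n \<noteq> 1"
    and "simple_affine_module X q W" and "finite_dim (scl W) UNIV"
    and "has_drinfeld_polynomials X q W P"
    and "\<And>i. i \<in> verts X \<Longrightarrow> P (sigma X i) = P i"
    and "in_torus X u" and "\<And>i. i \<in> verts X \<Longrightarrow> u (sigma X i) = u i"
    and "(\<forall>i\<in>verts X. \<kappa> i = root_value X u i) \<or> (\<forall>i\<in>verts X. \<kappa> i = inverse (root_value X u i))"
    and "\<And>j. j \<in> verts X \<Longrightarrow> is_prefundamental_plus X q j 1 (Rp j)"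
    and "\<And>j. j \<in> verts X \<Longrightarrow> is_prefundamental_minus X q j 1 (Rm j)"
    and "v \<in> invariant_subspace X q Rp Rm u W" and "v \<noteq> 0"
    and "\<And>j n. j \<in> verts X \<Longrightarrow>
           transfer_ss X q (Rp j) u W n v = scl W (fps_nth (\<Lambda> j) n) v"
    and "baxter_prefactors X q P f"
    and "\<And>j. j \<in> verts X \<Longrightarrow> \<Lambda> j = f j * fps_of_poly (B j)"
    and "\<And>j. j \<in> verts X \<Longrightarrow> lists_roots (B j) (m j) (w j)"
    and "bethe_equations X q \<kappa> P m w"
  shows "(\<exists>m' w'. identified_roots X m w m' w') \<and>
    (\<forall>m' w'. identified_roots X m w m' w' \<longrightarrow> folded_bethe_equations X q \<kappa> P m' w')"
proof -
  note X = assms(1)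
  interpret drinfeld_module X q W P using assms(2-4,6) by unfold_locales
  have P0: "P i \<noteq> 0" if "i \<in> verts X" for i
    using assms(6) that by (force simp: has_drinfeld_polynomials_def)
  have "B (sigma X j) = B j" if j: "j \<in> verts X" for j
  proof -
    have sj: "sigma X j \<in> verts X" by (rule sigma_in_verts[OF X j])
    \<comment> \<open>Both operators act on \<open>v\<close> alike, and \<open>v \<noteq> 0\<close>
      allows the scalars to be compared.\<close>
    have "fps_nth (\<Lambda> (sigma X j)) n = fps_nth (\<Lambda> j) n" for n
      using transfer_ss_eq_on_invariant_subspace[OF assms(5,13) j, of n] assms(14)
      by (simp add: assms(15)[OF j] assms(15)[OF sj])
    hence "\<Lambda> (sigma X j) = \<Lambda> j" by (simp add: fps_eq_iff)
    moreover have "f (sigma X j) = f j"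
      by (rule baxter_prefactors_sigma[OF X assms(2,3,16) P0 assms(7) j])
    ultimately have "f j * fps_of_poly (B (sigma X j)) = f j * fps_of_poly (B j)"
      by (simp flip: assms(17)[OF j] add: assms(17)[OF sj])
    \<comment> \<open>The constant term 1 makes \<open>f j\<close> a nonzero element of an integral
      domain, so it cancels.\<close>
    moreover have "f j \<noteq> 0" using assms(16) j by (force simp: baxter_prefactors_def)
    ultimately show ?thesis by (simp add: fps_of_poly_eq_iff)
  qed
  from ex_identified_roots[of X B m w, OF X this assms(18)] show ?thesis
    using folded_bethe_equations_if_bethe_equations[OF X assms(19)] by blast
qed

end
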